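(* Given any topological space $A$, there is a weak equivalence between $S^D(C(A))$ and $sA$ in the category of simplicial sets (i.e. a weak equivalence of simplicial sets in one direction or the other between these two objects).
   Context: A diffeological space is a set $X$ together with, for each $n\in\mathbb{N}$ and each open $U\subseteq\mathbb{R}^n$, a specified set of functions $U\to X$ called plots, such that: every constant map is a plot; if $U\to X$ is a plot and $V\to U$ is a smooth map between open subsets of Euclidean spaces then the composite $V\to X$ is a plot; and a function $U\to X$ whose restriction to each member of some open cover of $U$ is a plot is itself a plot. A map $f:X\to Y$ is smooth if $f\circ p$ is a plot of $Y$ for every plot $p$ of $X$; $C^\infty(X,Y)$ is the set of smooth maps. $\mathbb{R}^n$ has as plots the usual smooth maps. A subset $A\subseteq X$ has the sub-diffeology: $U\to A$ is a plot iff $U\to A\hookrightarrow X$ is. For a topological space $A$, $C(A)$ is the set $A$ with the continuous diffeology, whose plots $U\to A$ are the continuous maps. $sA$ is the usual singular simplicial set of $A$, with $n$-simplices the continuous maps from the standard topological simplex $|\Delta^n|$ to $A$. Let $\mathbb{A}^n=\{(x_0,\dots,x_n)\in\mathbb{R}^{n+1}\mid\sum x_i=1\}$ with the sub-diffeology from $\mathbb{R}^{n+1}$. A map $f:\{0,\dots,n\}\to\{0,\dots,m\}$ in the simplicial category induces $f_*:\mathbb{A}^n\to\mathbb{A}^m$, $f_*(x)_j=\sum_{i\in f^{-1}(j)}x_i$. $S^D(X)$ is the simplicial set with $S^D_n(X)=C^\infty(\mathbb{A}^n,X)$ and structure maps given by precomposition. A map of simplicial sets is a weak equivalence if its geometric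 realization is a homotopy equivalence. *)

theory Defs
  imports "HOL-Analysis.Analysis" "HOL-Homology.Homology"
begin

section \<open>Smooth maps between subsets of Euclidean spaces of varying dimension\<close>

text \<open>
  The space $R^n$ is \<^const>\<open>Euclidean_space\<close>, whose points are the sequences vanishing from
  index \<open>n\<close> on. A function whose domain is a set \<open>U\<close> is an element of
  \<^term>\<open>extensional U\<close>, so that equality of such functions is equality on \<open>U\<close>.
\<close>

definition partial_deriv :: "nat \<Rightarrow> ((nat \<Rightarrow> real) \<Rightarrow> real) \<Rightarrow> (nat \<Rightarrow> real) \<Rightarrow> real" where
  "partial_deriv i f x = deriv (\<lambda>t. f (x(i := t))) (x i)"

text \<open>
  All iterated partial derivatives in the directions \<open>< n\<close> exist and are continuous on \<open>U\<close>.
  This is only used for \<open>U\<close> open in $R^n$; then \<^const>\<open>partial_deriv\<close> at a point of \<open>U\<close>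
  depends only on the values of the function on \<open>U\<close>.
\<close>

definition smooth_real :: "nat \<Rightarrow> (nat \<Rightarrow> real) set \<Rightarrow> ((nat \<Rightarrow> real) \<Rightarrow> real) \<Rightarrow> bool" where
  "smooth_real n U f \<longleftrightarrow>
     (\<forall>ds. set ds \<subseteq> {..<n} \<longrightarrow>
        continuous_map (subtopology (Euclidean_space n) U) euclideanreal (foldr partial_deriv ds f) \<and>
        (\<forall>x\<in>U. \<forall>i<n. (\<lambda>t. foldr partial_deriv ds f (x(i := t))) field_differentiable at (x i)))"

definition smooth_euclidean ::
    "nat \<Rightarrow> (nat \<Rightarrow> real) set \<Rightarrow> nat \<Rightarrow> (nat \<Rightarrow> real) set \<Rightarrow> ((nat \<Rightarrow> real) \<Rightarrow> (nat \<Rightarrow> real)) \<Rightarrow> bool" where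
  "smooth_euclidean n U m V g \<longleftrightarrow>
     g \<in> U \<rightarrow> V \<and> (\<forall>j<m. smooth_real n U (\<lambda>x. g x j))"


section \<open>Diffeological spaces\<close>

text \<open>
  \<open>Plots X n U\<close> is the set of plots \<open>U \<rightarrow> X\<close>; it is only meaningful for \<open>U\<close> open in $R^n$.
\<close>

record 'x diffeology =
  Points :: "'x set"
  Plots :: "nat \<Rightarrow> (nat \<Rightarrow> real) set \<Rightarrow> ((nat \<Rightarrow> real) \<Rightarrow> 'x) set"

definition diffeological_space :: "'x diffeology \<Rightarrow> bool" where
  "diffeological_space X \<longleftrightarrow>
     (\<forall>n U. openin (Euclidean_space n) U \<longrightarrow> Plots X n U \<subseteq> U \<rightarrow>\<^sub>E Points X) \<and>
     (\<forall>n U c. openin (Euclidean_space n) U \<and> c \<in> Points X \<longrightarrow> (\<lambda>x\<in>U. c) \<in> Plots X n U) \<and>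
     (\<forall>n U m V p g. openin (Euclidean_space n) U \<and> openin (Euclidean_space m) V \<and>
        p \<in> Plots X n U \<and> smooth_euclidean m V n U g \<longrightarrow> compose V p g \<in> Plots X m V) \<and>
     (\<forall>n U \<U> p. openin (Euclidean_space n) U \<and> p \<in> U \<rightarrow>\<^sub>E Points X \<and>
        (\<forall>V\<in>\<U>. openin (Euclidean_space n) V) \<and> \<Union>\<U> = U \<and>
        (\<forall>V\<in>\<U>. restrict p V \<in> Plots X n V) \<longrightarrow> p \<in> Plots X n U)"

definition smooth_maps :: "'x diffeology \<Rightarrow> 'y diffeology \<Rightarrow> ('x \<Rightarrow> 'y) set" where
  "smooth_maps X Y =
     {f \<in> Points X \<rightarrow>\<^sub>E Points Y.
        \<forall>n U. openin (Euclidean_space n) U \<longrightarrow> (\<forall>p\<in>Plots X n U. compose U f p \<in> Plots Y n U)}"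

definition euclidean_diffeology :: "nat \<Rightarrow> (nat \<Rightarrow> real) diffeology" where
  "euclidean_diffeology k =
     \<lparr>Points = topspace (Euclidean_space k),
      Plots = (\<lambda>n U. {p \<in> extensional U. smooth_euclidean n U k (topspace (Euclidean_space k)) p})\<rparr>"

definition sub_diffeology :: "'x diffeology \<Rightarrow> 'x set \<Rightarrow> 'x diffeology" where
  "sub_diffeology X A =
     \<lparr>Points = Points X \<inter> A, Plots = (\<lambda>n U. {p \<in> Plots X n U. p ` U \<subseteq> A})\<rparr>"

definition continuous_diffeology :: "'a topology \<Rightarrow> 'a diffeology" where
  "continuous_diffeology A =
     \<lparr>Points = topspace A,
      Plots = (\<lambda>n U. {p \<in> extensional U. continuous_map (subtopology (Euclidean_space n) U) A p})\<rparr>"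

lemma smooth_euclidean_continuous:
  assumes g: "smooth_euclidean m V n U g" and U: "U \<subseteq> topspace (Euclidean_space n)"
  shows "continuous_map (subtopology (Euclidean_space m) V) (subtopology (Euclidean_space n) U) g"
proof -
  let ?V = "subtopology (Euclidean_space m) V"
  have im: "g x \<in> U" if "x \<in> V" for x
    using g that by (auto simp: smooth_euclidean_def)
  have "continuous_map ?V euclideanreal (\<lambda>x. g x i)" if "i < n" for i
  proof -
    have "smooth_real m V (\<lambda>x. g x i)"
      using g that by (simp add: smooth_euclidean_def)
    then show ?thesis
      unfolding smooth_real_def by (auto dest: spec[of _ "[]"])
  qed
  then have "continuous_map ?V (Euclidean_space n) (\<lambda>x i. if i < n then g x i else 0)"
    by (simp add: continuous_map_componentwise_Euclidean_space)
  moreover have "(\<lambda>i. if i < n then g x i else 0) = g x" if "x \<in> topspace ?V" for x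
  proof -
    have "g x \<in> topspace (Euclidean_space n)"
      using im[of x] U that by auto
    then show ?thesis
      by (auto simp: topspace_Euclidean_space)
  qed
  ultimately have "continuous_map ?V (Euclidean_space n) g"
    by (rule continuous_map_eq)
  then show ?thesis
    using im by (auto simp: continuous_map_in_subtopology)
qed

lemma diffeological_space_continuous_diffeology:
  "diffeological_space (continuous_diffeology A)"
  unfolding diffeological_space_def
proof (intro conjI allI impI)
  fix n U assume "openin (Euclidean_space n) U"
  then show "Plots (continuous_diffeology A) n U \<subseteq> U \<rightarrow>\<^sub>E Points (continuous_diffeology A)"
    using openin_subset[of "Euclidean_space n" U]
    by (auto simp: continuous_diffeology_def PiE_def continuous_map_def Pi_def)
next
  fix n U c
  assume "openin (Euclidean_space n) U \<and> c \<in> Points (continuous_diffeology A)"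
  moreover have "continuous_map (subtopology (Euclidean_space n) U) A (\<lambda>x\<in>U. c)"
    if "c \<in> topspace A"
    by (rule continuous_map_eq[of _ _ "\<lambda>x. c"]) (use that in auto)
  ultimately show "(\<lambda>x\<in>U. c) \<in> Plots (continuous_diffeology A) n U"
    by (simp add: continuous_diffeology_def)
next
  fix n U m V p g
  assume a: "openin (Euclidean_space n) U \<and> openin (Euclidean_space m) V \<and>
    p \<in> Plots (continuous_diffeology A) n U \<and> smooth_euclidean m V n U g"
  then have "continuous_map (subtopology (Euclidean_space m) V) A (p \<circ> g)"
    by (intro continuous_map_compose[OF smooth_euclidean_continuous])
       (auto simp: continuous_diffeology_def dest: openin_subset)
  then have "continuous_map (subtopology (Euclidean_space m) V) A (compose V p g)"
    by (rule continuous_map_eq) (auto simp: compose_def)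
  then show "compose V p g \<in> Plots (continuous_diffeology A) m V"
    by (simp add: continuous_diffeology_def)
next
  fix n U \<U> p
  let ?X = "subtopology (Euclidean_space n) U"
  assume a: "openin (Euclidean_space n) U \<and> p \<in> U \<rightarrow>\<^sub>E Points (continuous_diffeology A) \<and>
    (\<forall>V\<in>\<U>. openin (Euclidean_space n) V) \<and> \<Union>\<U> = U \<and>
    (\<forall>V\<in>\<U>. restrict p V \<in> Plots (continuous_diffeology A) n V)"
  have "continuous_map ?X A p"
  proof (rule pasting_lemma[where I = \<U> and T = "\<lambda>V. V" and f = "\<lambda>V. p"])
    fix V assume V: "V \<in> \<U>"
    then show "openin ?X V"
      using a by (auto simp: openin_open_subtopology)
    have "continuous_map (subtopology (Euclidean_space n) V) A (restrict p V)"
      using a V by (simp add: continuous_diffeology_def)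
    then have "continuous_map (subtopology (Euclidean_space n) V) A p"
      by (rule continuous_map_eq) auto
    moreover have "U \<inter> V = V" using a V by auto
    ultimately show "continuous_map (subtopology ?X V) A p"
      by (simp add: subtopology_subtopology)
  next
    fix x assume "x \<in> topspace ?X"
    then show "\<exists>j. j \<in> \<U> \<and> x \<in> j \<and> p x = p x" using a by auto
  qed auto
  then show "p \<in> Plots (continuous_diffeology A) n U"
    using a by (simp add: continuous_diffeology_def PiE_iff)
qed


section \<open>Simplicial sets\<close>

text \<open>The ordered set $[n]$ is \<open>{..n}\<close>; \<open>Delta n m\<close> is the set of morphisms $[n] \to [m]$.\<close>

definition Delta :: "nat \<Rightarrow> nat \<Rightarrow> (nat \<Rightarrow> nat) set" where
  "Delta n m = {f \<in> {..n} \<rightarrow>\<^sub>E {..m}. mono_on {..n} f}"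

text \<open>For \<open>f \<in> Delta n m\<close>, \<open>Act X n m f\<close> is the structure map $X_m \to X_n$ induced by \<open>f\<close>.\<close>

record 'x sset =
  Simp :: "nat \<Rightarrow> 'x set"
  Act :: "nat \<Rightarrow> nat \<Rightarrow> (nat \<Rightarrow> nat) \<Rightarrow> 'x \<Rightarrow> 'x"

definition simplicial_set :: "'x sset \<Rightarrow> bool" where
  "simplicial_set X \<longleftrightarrow>
     (\<forall>n m. \<forall>f\<in>Delta n m. Act X n m f \<in> Simp X m \<rightarrow> Simp X n) \<and>
     (\<forall>n. \<forall>x\<in>Simp X n. Act X n n (\<lambda>i\<in>{..n}. i) x = x) \<and>
     (\<forall>n m k. \<forall>f\<in>Delta n m. \<forall>g\<in>Delta m k. \<forall>x\<in>Simp X k.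
        Act X n k (compose {..n} g f) x = Act X n m f (Act X m k g x))"

definition simplicial_map :: "'x sset \<Rightarrow> 'y sset \<Rightarrow> (nat \<Rightarrow> 'x \<Rightarrow> 'y) \<Rightarrow> bool" where
  "simplicial_map X Y \<phi> \<longleftrightarrow>
     simplicial_set X \<and> simplicial_set Y \<and>
     (\<forall>n. \<phi> n \<in> Simp X n \<rightarrow> Simp Y n) \<and>
     (\<forall>n m. \<forall>f\<in>Delta n m. \<forall>x\<in>Simp X m. \<phi> n (Act X n m f x) = Act Y n m f (\<phi> m x))"

text \<open>\<open>push n f\<close> is the map $f_*$, on the affine as well as on the standard simplex.\<close>

definition push :: "nat \<Rightarrow> (nat \<Rightarrow> nat) \<Rightarrow> (nat \<Rightarrow> real) \<Rightarrow> (nat \<Rightarrow> real)" where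
  "push n f x = (\<lambda>j. \<Sum>i | i \<le> n \<and> f i = j. x i)"


section \<open>The singular and the smooth singular simplicial set\<close>

definition singular_sset :: "'a topology \<Rightarrow> ((nat \<Rightarrow> real) \<Rightarrow> 'a) sset" where
  "singular_sset A =
     \<lparr>Simp = (\<lambda>n. {\<sigma>. singular_simplex n A \<sigma>}),
      Act = (\<lambda>n m f \<sigma>. compose (standard_simplex n) \<sigma> (push n f))\<rparr>"

definition affine_simplex :: "nat \<Rightarrow> (nat \<Rightarrow> real) set" where
  "affine_simplex n = {x \<in> topspace (Euclidean_space (Suc n)). (\<Sum>i\<le>n. x i) = 1}"

definition affine_simplex_diffeology :: "nat \<Rightarrow> (nat \<Rightarrow> real) diffeology" where
  "affine_simplex_diffeology n = sub_diffeology (euclidean_diffeology (Suc n)) (affine_simplex n)"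

definition smooth_sset :: "'x diffeology \<Rightarrow> ((nat \<Rightarrow> real) \<Rightarrow> 'x) sset" where
  "smooth_sset X =
     \<lparr>Simp = (\<lambda>n. smooth_maps (affine_simplex_diffeology n) X),
      Act = (\<lambda>n m f \<sigma>. compose (affine_simplex n) \<sigma> (push n f))\<rparr>"


lemma push_id: "(\<And>i. i > n \<Longrightarrow> x i = 0) \<Longrightarrow> push n (\<lambda>i\<in>{..n}. i) x = x"
proof
  fix j assume 0: "\<And>i. i > n \<Longrightarrow> x i = 0"
  have "{i. i \<le> n \<and> (\<lambda>i\<in>{..n}. i) i = j} = (if j \<le> n then {j} else {})"
    by auto
  then show "push n (\<lambda>i\<in>{..n}. i) x j = x j"
    using 0 by (simp add: push_def)
qed

lemma push_compose:
  assumes "f \<in> Delta n m"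
  shows "push n (compose {..n} g f) x = push m g (push n f x)"
proof
  fix j
  have f: "f i \<le> m" if "i \<le> n" for i
    using assms that by (auto simp: Delta_def)
  have "push m g (push n f x) j =
      (\<Sum>k | k \<le> m \<and> g k = j. sum x {i \<in> {i. i \<le> n \<and> g (f i) = j}. f i = k})"
    unfolding push_def by (intro sum.cong) (auto intro!: arg_cong[where f = "sum x"])
  also have "\<dots> = sum x {i. i \<le> n \<and> g (f i) = j}"
    by (rule sum.group) (auto simp: f)
  also have "{i. i \<le> n \<and> g (f i) = j} = {i. i \<le> n \<and> compose {..n} g f i = j}"
    by (auto simp: compose_def)
  finally show "push n (compose {..n} g f) x j = push m g (push n f x) j"
    by (simp add: push_def)
qed

lemma
  assumes "f \<in> Delta n m"
  shows sum_push: "(\<Sum>j\<le>m. push n f x j) = (\<Sum>i\<le>n. x i)"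
    and push_eq_0: "j > m \<Longrightarrow> push n f x j = 0"
proof -
  have f: "f i \<le> m" if "i \<le> n" for i
    using assms that by (auto simp: Delta_def)
  have "(\<Sum>j\<le>m. push n f x j) = (\<Sum>j\<le>m. sum x {i \<in> {..n}. f i = j})"
    by (simp add: push_def)
  also have "\<dots> = (\<Sum>i\<le>n. x i)"
    by (rule sum.group) (auto simp: f)
  finally show "(\<Sum>j\<le>m. push n f x j) = (\<Sum>i\<le>n. x i)" .
  show "push n f x j = 0" if "j > m"
  proof -
    have "{i. i \<le> n \<and> f i = j} = {}" using that f by fastforce
    then show ?thesis by (simp only: push_def sum.empty)
  qed
qed

lemma push_standard_simplex:
  assumes f: "f \<in> Delta n m" and x: "x \<in> standard_simplex n"
  shows "push n f x \<in> standard_simplex m"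
proof -
  have nonneg: "0 \<le> push n f x j" for j
    using x by (auto simp: push_def standard_simplex_def intro!: sum_nonneg)
  have "push n f x j \<le> (\<Sum>i\<le>n. x i)" for j
    unfolding push_def using x by (intro sum_mono2) (auto simp: standard_simplex_def)
  then show ?thesis
    using nonneg x sum_push[OF f] push_eq_0[OF f] by (auto simp: standard_simplex_def)
qed

lemma push_affine_simplex:
  assumes f: "f \<in> Delta n m" and x: "x \<in> affine_simplex n"
  shows "push n f x \<in> affine_simplex m"
  using x sum_push[OF f] push_eq_0[OF f]
  by (auto simp: affine_simplex_def topspace_Euclidean_space Suc_le_eq)

lemma continuous_map_push:
  "continuous_map (powertop_real UNIV) (powertop_real UNIV) (push n f)"
  unfolding continuous_map_componentwise_UNIV push_def
  by (auto intro!: continuous_map_sum continuous_map_product_projection)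

lemma simplicial_set_singular_sset: "simplicial_set (singular_sset A)"
  unfolding simplicial_set_def
proof (intro conjI allI ballI)
  fix n m f assume f: "f \<in> Delta n m"
  let ?D = "\<lambda>n. subtopology (powertop_real UNIV) (standard_simplex n)"
  have push: "continuous_map (?D n) (?D m) (push n f)"
    using push_standard_simplex[OF f]
    by (auto simp: continuous_map_in_subtopology continuous_map_from_subtopology continuous_map_push)
  have "singular_simplex n A (compose (standard_simplex n) \<sigma> (push n f))"
    if "singular_simplex m A \<sigma>" for \<sigma>
  proof -
    have "continuous_map (?D n) A (\<sigma> \<circ> push n f)"
      using that by (intro continuous_map_compose[OF push]) (simp add: singular_simplex_def)
    then have "continuous_map (?D n) A (compose (standard_simplex n) \<sigma> (push n f))"
      by (rule continuous_map_eq) (simp add: compose_def)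
    then show ?thesis
      by (simp add: singular_simplex_def compose_def)
  qed
  then show "Act (singular_sset A) n m f \<in> Simp (singular_sset A) m \<rightarrow> Simp (singular_sset A) n"
    by (simp add: singular_sset_def)
next
  fix n \<sigma> assume "\<sigma> \<in> Simp (singular_sset A) n"
  then show "Act (singular_sset A) n n (\<lambda>i\<in>{..n}. i) \<sigma> = \<sigma>"
    by (auto simp: singular_sset_def singular_simplex_def compose_def fun_eq_iff extensional_def
          standard_simplex_def push_id)
next
  fix n m k f g \<sigma> assume f: "f \<in> Delta n m"
  show "Act (singular_sset A) n k (compose {..n} g f) \<sigma> =
      Act (singular_sset A) n m f (Act (singular_sset A) m k g \<sigma>)"
    by (simp add: singular_sset_def fun_eq_iff compose_def[of "standard_simplex _"] push_compose[OF f] push_standard_simplex[OF f])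
qed

text \<open>
  Iterated partial derivatives commute with finite sums of smooth functions, so $f_*$ is
  smooth on the affine simplices and \<open>smooth_sset X\<close> is a simplicial set.
\<close>

lemma partial_line_open:
  assumes U: "openin (Euclidean_space n) U" and x: "x \<in> U" and i: "i < n"
  shows "\<forall>\<^sub>F t in nhds (x i). x(i := t) \<in> U"
proof -
  have "continuous_map euclideanreal (Euclidean_space n) (\<lambda>t. x(i := t))"
    using x i openin_subset[OF U]
    by (fastforce simp: Euclidean_space_def continuous_map_in_subtopology
          continuous_map_componentwise_UNIV fun_upd_def)
  then have "open {t. x(i := t) \<in> U}"
    using openin_continuous_map_preimage[OF _ U] by fastforce
  then show ?thesis
    using eventually_nhds_in_open[of _ "x i"] x by fastforce
qed

lemma smooth_real_sum:
  fixes g :: "'i \<Rightarrow> (nat \<Rightarrow> real) \<Rightarrow> real"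
  assumes U: "openin (Euclidean_space n) U" and S: "finite S"
    and g: "\<And>a. a \<in> S \<Longrightarrow> smooth_real n U (g a)"
    and h: "\<And>x. x \<in> U \<Longrightarrow> h x = (\<Sum>a\<in>S. g a x)"
  shows "smooth_real n U h"
proof -
  let ?D = "\<lambda>ds f. foldr partial_deriv ds f"
  have line: "((\<lambda>t. ?D ds h (x(i := t))) has_field_derivative
                 (\<Sum>a\<in>S. deriv (\<lambda>t. ?D ds (g a) (x(i := t))) (x i))) (at (x i))"
    if eq: "\<And>x. x \<in> U \<Longrightarrow> ?D ds h x = (\<Sum>a\<in>S. ?D ds (g a) x)"
      and ds: "set ds \<subseteq> {..<n}" and x: "x \<in> U" and i: "i < n" for ds x i
  proof -
    have "((\<lambda>t. \<Sum>a\<in>S. ?D ds (g a) (x(i := t))) has_field_derivative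
             (\<Sum>a\<in>S. deriv (\<lambda>t. ?D ds (g a) (x(i := t))) (x i))) (at (x i))"
      using g ds x i unfolding smooth_real_def
      by (intro DERIV_sum) (simp add: field_differentiable_derivI)
    moreover have "\<forall>\<^sub>F t in nhds (x i). ?D ds h (x(i := t)) = (\<Sum>a\<in>S. ?D ds (g a) (x(i := t)))"
      using partial_line_open[OF U x i] by eventually_elim (rule eq)
    ultimately show ?thesis
      by (subst DERIV_cong_ev[OF refl _ refl]) auto
  qed
  have eq: "?D ds h x = (\<Sum>a\<in>S. ?D ds (g a) x)" if "set ds \<subseteq> {..<n}" "x \<in> U" for ds x
    using that
  proof (induction ds arbitrary: x)
    case Nil
    then show ?case by (simp add: h)
  next
    case (Cons i ds)
    then show ?case
      using line[of ds x i] by (simp add: partial_deriv_def[of i] DERIV_imp_deriv)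
  qed
  show ?thesis
    unfolding smooth_real_def
  proof (intro allI impI conjI ballI)
    fix ds assume ds: "set ds \<subseteq> {..<n}"
    have "continuous_map (subtopology (Euclidean_space n) U) euclideanreal (\<lambda>x. \<Sum>a\<in>S. ?D ds (g a) x)"
      using g ds S unfolding smooth_real_def by (intro continuous_map_sum) auto
    then show "continuous_map (subtopology (Euclidean_space n) U) euclideanreal (?D ds h)"
      by (rule continuous_map_eq) (use eq ds in auto)
    show "(\<lambda>t. ?D ds h (x(i := t))) field_differentiable at (x i)" if "x \<in> U" "i < n" for x i
      using line[OF eq[OF ds] ds that] by (auto simp: field_differentiable_def)
  qed
qed

lemma push_smooth:
  assumes f: "f \<in> Delta n m" and U: "openin (Euclidean_space k) U"
    and p: "p \<in> Plots (affine_simplex_diffeology n) k U"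
  shows "compose U (push n f) p \<in> Plots (affine_simplex_diffeology m) k U"
proof -
  have p': "p \<in> U \<rightarrow> affine_simplex n" "\<And>j. j \<le> n \<Longrightarrow> smooth_real k U (\<lambda>x. p x j)"
    using p by (auto simp: affine_simplex_diffeology_def sub_diffeology_def
        euclidean_diffeology_def smooth_euclidean_def less_Suc_eq_le)
  have im: "compose U (push n f) p \<in> U \<rightarrow> affine_simplex m"
    using p'(1) push_affine_simplex[OF f] by (auto simp: compose_def)
  moreover have "smooth_real k U (\<lambda>x. compose U (push n f) p x j)" for j
    by (rule smooth_real_sum[OF U, where S = "{i. i \<le> n \<and> f i = j}" and g = "\<lambda>i x. p x i"])
       (auto simp: compose_def push_def p'(2))
  moreover have "affine_simplex m \<subseteq> topspace (Euclidean_space (Suc m))"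
    by (auto simp: affine_simplex_def)
  ultimately show ?thesis
    by (auto simp: affine_simplex_diffeology_def sub_diffeology_def
        euclidean_diffeology_def smooth_euclidean_def)
qed

lemma Points_affine_simplex_diffeology [simp]:
  "Points (affine_simplex_diffeology n) = affine_simplex n"
  by (auto simp: affine_simplex_diffeology_def sub_diffeology_def euclidean_diffeology_def
      affine_simplex_def)

lemma simplicial_set_smooth_sset: "simplicial_set (smooth_sset X)"
  unfolding simplicial_set_def
proof (intro conjI allI ballI)
  fix n m f assume f: "f \<in> Delta n m"
  have "compose (affine_simplex n) \<sigma> (push n f) \<in> smooth_maps (affine_simplex_diffeology n) X"
    if \<sigma>: "\<sigma> \<in> smooth_maps (affine_simplex_diffeology m) X" for \<sigma>
    unfolding smooth_maps_def Points_affine_simplex_diffeology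
  proof (intro CollectI conjI allI impI ballI)
    show "compose (affine_simplex n) \<sigma> (push n f) \<in> affine_simplex n \<rightarrow>\<^sub>E Points X"
      using \<sigma> push_affine_simplex[OF f] by (auto simp: smooth_maps_def compose_def PiE_def Pi_def)
  next
    fix k U p assume U: "openin (Euclidean_space k) U"
      and p: "p \<in> Plots (affine_simplex_diffeology n) k U"
    have "p \<in> U \<rightarrow> affine_simplex n"
      using p by (auto simp: affine_simplex_diffeology_def sub_diffeology_def)
    then have "compose U (compose (affine_simplex n) \<sigma> (push n f)) p =
        compose U \<sigma> (compose U (push n f) p)"
      by (auto simp: compose_def fun_eq_iff)
    then show "compose U (compose (affine_simplex n) \<sigma> (push n f)) p \<in> Plots X k U"
      using \<sigma> U push_smooth[OF f U p] by (simp add: smooth_maps_def)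
  qed
  then show "Act (smooth_sset X) n m f \<in> Simp (smooth_sset X) m \<rightarrow> Simp (smooth_sset X) n"
    by (simp add: smooth_sset_def)
next
  fix n \<sigma> assume "\<sigma> \<in> Simp (smooth_sset X) n"
  then show "Act (smooth_sset X) n n (\<lambda>i\<in>{..n}. i) \<sigma> = \<sigma>"
    by (auto simp: smooth_sset_def smooth_maps_def compose_def fun_eq_iff PiE_def extensional_def
          affine_simplex_def topspace_Euclidean_space push_id)
next
  fix n m k f g \<sigma> assume f: "f \<in> Delta n m"
  show "Act (smooth_sset X) n k (compose {..n} g f) \<sigma> =
      Act (smooth_sset X) n m f (Act (smooth_sset X) m k g \<sigma>)"
    by (simp add: smooth_sset_def fun_eq_iff compose_def[of "affine_simplex _"] push_compose[OF f] push_affine_simplex[OF f])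
qed


section \<open>Geometric realization and weak equivalences\<close>

definition quotient_topology :: "'a topology \<Rightarrow> ('a \<Rightarrow> 'b) \<Rightarrow> 'b topology" where
  "quotient_topology X q =
     topology (\<lambda>S. S \<subseteq> q ` topspace X \<and> openin X {x \<in> topspace X. q x \<in> S})"

lemma openin_quotient_topology:
  "openin (quotient_topology X q) S \<longleftrightarrow>
     S \<subseteq> q ` topspace X \<and> openin X {x \<in> topspace X. q x \<in> S}"
proof -
  have 1: "{x \<in> topspace X. q x \<in> S \<inter> T} = {x \<in> topspace X. q x \<in> S} \<inter> {x \<in> topspace X. q x \<in> T}" for S T
    by auto
  have 2: "{x \<in> topspace X. q x \<in> \<Union>K} = (\<Union>S\<in>K. {x \<in> topspace X. q x \<in> S})" for K
    by auto
  have "istopology (\<lambda>S. S \<subseteq> q ` topspace X \<and> openin X {x \<in> topspace X. q x \<in> S})"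
    unfolding istopology_def 1 2 by blast
  then show ?thesis
    by (simp add: quotient_topology_def)
qed

lemma topspace_quotient_topology [simp]: "topspace (quotient_topology X q) = q ` topspace X"
proof
  show "topspace (quotient_topology X q) \<subseteq> q ` topspace X"
    using openin_topspace[of "quotient_topology X q"] unfolding openin_quotient_topology by blast
  have "{x \<in> topspace X. q x \<in> q ` topspace X} = topspace X" by auto
  then have "openin (quotient_topology X q) (q ` topspace X)"
    by (simp add: openin_quotient_topology)
  then show "q ` topspace X \<subseteq> topspace (quotient_topology X q)"
    by (rule openin_subset)
qed

lemma quotient_map_quotient_topology: "quotient_map X (quotient_topology X q) q"
  by (simp add: quotient_map_def openin_quotient_topology)

text \<open>The disjoint union of the spaces $X_n \times |\Delta^n|$, with \<open>X\<^sub>n\<close> discrete.\<close>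

definition simplex_sum :: "'x sset \<Rightarrow> (nat \<times> 'x \<times> (nat \<Rightarrow> real)) topology" where
  "simplex_sum X =
     sum_topology (\<lambda>n. prod_topology (discrete_topology (Simp X n))
                         (subtopology (powertop_real UNIV) (standard_simplex n))) UNIV"

definition glue :: "'x sset \<Rightarrow> (nat \<times> 'x \<times> (nat \<Rightarrow> real)) rel" where
  "glue X = {((n, Act X n m f x, t), (m, x, push n f t)) | n m f x t.
               f \<in> Delta n m \<and> x \<in> Simp X m \<and> t \<in> standard_simplex n}"

text \<open>The equivalence relation generated by \<^const>\<open>glue\<close>.\<close>

definition realization_rel :: "'x sset \<Rightarrow> (nat \<times> 'x \<times> (nat \<Rightarrow> real)) rel" where
  "realization_rel X = (glue X \<union> (glue X)\<inverse>)\<^sup>*"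

definition realization :: "'x sset \<Rightarrow> (nat \<times> 'x \<times> (nat \<Rightarrow> real)) set topology" where
  "realization X = quotient_topology (simplex_sum X) (\<lambda>p. realization_rel X `` {p})"

text \<open>The map $[n,x,t] \mapsto [n,\varphi_n(x),t]$, written as a map on equivalence classes.\<close>

definition realization_map ::
    "'y sset \<Rightarrow> (nat \<Rightarrow> 'x \<Rightarrow> 'y)
      \<Rightarrow> (nat \<times> 'x \<times> (nat \<Rightarrow> real)) set \<Rightarrow> (nat \<times> 'y \<times> (nat \<Rightarrow> real)) set" where
  "realization_map Y \<phi> C = realization_rel Y `` ((\<lambda>(n, x, t). (n, \<phi> n x, t)) ` C)"

lemma realization_map_class:
  assumes \<phi>: "simplicial_map X Y \<phi>"
  shows "realization_map Y \<phi> (realization_rel X `` {(n, x, t)}) = realization_rel Y `` {(n, \<phi> n x, t)}"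
proof -
  define F where "F = (\<lambda>(n, x, t :: nat \<Rightarrow> real). (n :: nat, \<phi> n x, t))"
  have glue: "(F p, F q) \<in> glue Y" if pq_glue: "(p, q) \<in> glue X" for p q
  proof -
    obtain n m f x t where pq: "p = (n, Act X n m f x, t)" "q = (m, x, push n f t)"
      and f: "f \<in> Delta n m" and x: "x \<in> Simp X m" and t: "t \<in> standard_simplex n"
      using pq_glue by (auto simp: glue_def)
    have "\<phi> n (Act X n m f x) = Act Y n m f (\<phi> m x)"
      using \<phi> f x unfolding simplicial_map_def by blast
    moreover have "\<phi> m x \<in> Simp Y m"
      using \<phi> x unfolding simplicial_map_def by blast
    ultimately show ?thesis
      unfolding glue_def pq F_def using f t by (simp only: prod.case) blast
  qed
  have rel: "(F p, F q) \<in> realization_rel Y" if "(p, q) \<in> realization_rel X" for p q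
    using that unfolding realization_rel_def
  proof (induction rule: rtrancl_induct)
    case (step y z)
    then have "(F y, F z) \<in> glue Y \<union> (glue Y)\<inverse>"
      using glue by blast
    with step.IH show ?case by (rule rtrancl_into_rtrancl)
  qed (rule rtrancl_refl)
  have refl: "(p, p) \<in> realization_rel X" for p
    unfolding realization_rel_def by (rule rtrancl_refl)
  have "realization_rel Y `` (F ` (realization_rel X `` {p})) = realization_rel Y `` {F p}" for p
  proof (intro equalityI subsetI)
    fix z assume "z \<in> realization_rel Y `` (F ` (realization_rel X `` {p}))"
    then obtain y where "(p, y) \<in> realization_rel X" and y: "(F y, z) \<in> realization_rel Y"
      by blast
    then have "(F p, F y) \<in> realization_rel Y"
      by (intro rel)
    then show "z \<in> realization_rel Y `` {F p}"
      using y unfolding realization_rel_def by (auto intro: rtrancl_trans)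
  next
    fix z assume "z \<in> realization_rel Y `` {F p}"
    then show "z \<in> realization_rel Y `` (F ` (realization_rel X `` {p}))"
      using refl[of p] by blast
  qed
  from this[of "(n, x, t)"] show ?thesis
    by (simp add: realization_map_def F_def)
qed

definition homotopy_equivalence_map :: "'a topology \<Rightarrow> 'b topology \<Rightarrow> ('a \<Rightarrow> 'b) \<Rightarrow> bool" where
  "homotopy_equivalence_map X Y f \<longleftrightarrow>
     continuous_map X Y f \<and>
     (\<exists>g. continuous_map Y X g \<and>
          homotopic_with (\<lambda>_. True) X X (g \<circ> f) id \<and>
          homotopic_with (\<lambda>_. True) Y Y (f \<circ> g) id)"

definition weak_equivalence :: "'x sset \<Rightarrow> 'y sset \<Rightarrow> (nat \<Rightarrow> 'x \<Rightarrow> 'y) \<Rightarrow> bool" where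
  "weak_equivalence X Y \<phi> \<longleftrightarrow>
     simplicial_map X Y \<phi> \<and>
     homotopy_equivalence_map (realization X) (realization Y) (realization_map Y \<phi>)"

end

theory Submission
  imports Defs
begin

text \<open>
  Write $\mathbb{A}^n$ for the affine simplex and $S$ for the smooth singular simplicial set of the
  continuous diffeology on \<open>A\<close>. Since $\mathbb{A}^n$ is diffeomorphic to $R^n$, the \<open>n\<close>-simplices
  of $S$ are just the continuous maps $\mathbb{A}^n \to A$ (\<open>Simp_smooth_sset_continuous\<close>), and
  restriction along $|\Delta^n| \subseteq \mathbb{A}^n$ is a simplicial map $\rho: S \to sA$. It is
  shown to be a homotopy equivalence after realization, with a homotopy inverse induced by a
  simplicial section.

  The geometric input is that $\mathbb{A}^n$ retracts onto the union of $|\Delta^n|$ and the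
  hyperplanes $x_j = 0$: each region of $\mathbb{A}^n$ with a fixed pattern of signs, some of
  them negative, is an unbounded polyhedron and can be pushed onto its boundary along a fixed direction.
  This is the lifting property that makes $\rho$ a trivial fibration. The lemma
  \<open>affine_simplex_retract\<close> proves it together with a version relative to the ends of an interval:
  $\mathbb{A}^n \times T$ retracts onto its boundary part, $|\Delta^n| \times T$ and the points
  over $\pm 1$, where $T$ is $\{0\}$ or $[-1,1]$.

  By induction over skeleta, a natural family of maps given on $|\Delta^n| \times T$ and over
  $T \cap \{\pm 1\}$, indexed by the simplices of any simplicial set, extends to a natural family of
  maps on $\mathbb{A}^n \times T$ (\<open>extension_exists\<close>). On nondegenerate simplices the retraction
  gives the extension; on degenerate ones it is forced, and well defined because a simplex is
  the degeneracy of a unique nondegenerate simplex in a unique way (\<open>essential_rep_unique\<close>).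
  With $T = \{0\}$ and the simplicial set $sA$ this yields a simplicial section \<open>s\<close> of $\rho$
  (\<open>restriction_section\<close>). With $T = [-1,1]$ and the simplicial set $S$ it yields natural maps
  $H_\sigma: \mathbb{A}^n \times [-1,1] \to A$ from $s \rho \sigma$ to $\sigma$
  (\<open>section_homotopy\<close>).

  To turn the maps $H_\sigma$ into a homotopy $|S| \times [0,1] \to |S|$, joins replace the
  triangulation of prisms. The vertices of $\mathbb{A}^{2n+1}$ are two copies of those of
  $\mathbb{A}^n$; adding up corresponding coordinates, and recording the total weight of the second
  copy, maps $\mathbb{A}^{2n+1}$ to $\mathbb{A}^n \times R$. Composing with $H_\sigma$ gives a
  $(2n+1)$-simplex $\tau_\sigma$ of $S$ whose two complementary \<open>n\<close>-dimensional faces are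
  $s \rho \sigma$ and $\sigma$. The homotopy sends the class of $(\sigma, t)$ at time \<open>v\<close> to the class
  of $\tau_\sigma$ at the point with coordinates $((1-v)t, vt)$ (\<open>realization_homotopy\<close>). It is
  continuous because the product of a quotient map with the identity of a compact interval has the
  universal property of a quotient map (\<open>continuous_map_prod_quotient\<close>).
\<close>

section \<open>Simplices as continuous maps\<close>

lemma powertop_real_euclidean: "powertop_real UNIV = (euclidean :: (nat \<Rightarrow> real) topology)"
  by (rule euclidean_product_topology)

lemma continuous_on_nth: "continuous_on S (\<lambda>x::nat \<Rightarrow> real. x i)"
  by (rule continuous_on_subset[OF continuous_on_product_coordinates]) auto

lemma subtopology_Euclidean_space:
  assumes "U \<subseteq> topspace (Euclidean_space n)"
  shows "subtopology (Euclidean_space n) U = top_of_set U"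
  using assms
  by (simp add: Euclidean_space_def powertop_real_euclidean subtopology_subtopology Int_absorb1)

lemma mem_affine_simplex_iff:
  "y \<in> affine_simplex n \<longleftrightarrow> (\<forall>i>n. y i = 0) \<and> (\<Sum>i\<le>n. y i) = 1"
  by (auto simp: affine_simplex_def topspace_Euclidean_space Suc_le_eq)

lemma standard_simplex_eq: "standard_simplex n = {y \<in> affine_simplex n. \<forall>i. 0 \<le> y i}"
proof -
  have "y i \<le> 1" if y: "\<forall>i>n. y i = 0" "(\<Sum>i\<le>n. y i) = 1" "\<forall>i. 0 \<le> y i" for y :: "nat \<Rightarrow> real" and i
  proof (cases "i \<le> n")
    case True
    then have "y i \<le> (\<Sum>i\<le>n. y i)" using y by (intro member_le_sum) auto
    then show ?thesis using y by simp
  next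
    case False
    then show ?thesis using y by simp
  qed
  then show ?thesis
    by (auto simp: standard_simplex_def mem_affine_simplex_iff)
qed

lemma standard_subset_affine: "standard_simplex n \<subseteq> affine_simplex n"
  by (auto simp: standard_simplex_eq)

text \<open>
  Partial derivatives of affine functions are constant, so affine functions are closed under
  iterated partial derivatives.
\<close>

lemma smooth_real_affine: "smooth_real n U (\<lambda>x. c + (\<Sum>i<n. a i * x i))"
proof -
  define Aff where "Aff f \<longleftrightarrow> (\<exists>c a. f = (\<lambda>x::nat \<Rightarrow> real. c + (\<Sum>i<n. a i * x i :: real)))" for f
  have D: "((\<lambda>t. c + (\<Sum>i<n. a i * (x(j := t)) i)) has_field_derivative a j) (at s)"
    if "j < n" for c s and a :: "nat \<Rightarrow> real" and x :: "nat \<Rightarrow> real" and j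
  proof -
    have "(\<lambda>t. c + (\<Sum>i<n. a i * (x(j := t)) i)) =
        (\<lambda>t. (c + (\<Sum>i\<in>{..<n} - {j}. a i * x i)) + a j * t)"
    proof
      fix t
      have "(\<Sum>i\<in>{..<n} - {j}. a i * (x(j := t)) i) = (\<Sum>i\<in>{..<n} - {j}. a i * x i)"
        by (intro sum.cong) auto
      then show "c + (\<Sum>i<n. a i * (x(j := t)) i) = (c + (\<Sum>i\<in>{..<n} - {j}. a i * x i)) + a j * t"
        using that by (simp add: sum.remove[of "{..<n}" j])
    qed
    then show ?thesis by (auto intro!: derivative_eq_intros)
  qed
  have Aff: "Aff (foldr partial_deriv ds f)" if "set ds \<subseteq> {..<n}" "Aff f" for ds f
    using that
  proof (induction ds)
    case (Cons j ds)
    then obtain c a where "foldr partial_deriv ds f = (\<lambda>x. c + (\<Sum>i<n. a i * x i))"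
      by (auto simp: Aff_def)
    moreover have "partial_deriv j (\<lambda>x. c + (\<Sum>i<n. a i * x i)) = (\<lambda>x. a j)"
      unfolding partial_deriv_def using Cons.prems by (intro ext DERIV_imp_deriv D) auto
    ultimately have "foldr partial_deriv (j # ds) f = (\<lambda>x. a j + (\<Sum>i<n. 0 * x i))"
      by simp
    then show ?case
      unfolding Aff_def by (intro exI[of _ "a j"] exI[of _ "\<lambda>_. 0"])
  qed simp
  show ?thesis
    unfolding smooth_real_def
  proof (intro allI impI conjI ballI)
    fix ds assume "set ds \<subseteq> {..<n}"
    then obtain d b where eq: "foldr partial_deriv ds (\<lambda>x. c + (\<Sum>i<n. a i * x i)) = (\<lambda>x. d + (\<Sum>i<n. b i * x i))"
      using Aff[of ds "\<lambda>x. c + (\<Sum>i<n. a i * x i)"] unfolding Aff_def by blast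
    have "continuous_map (powertop_real UNIV) euclideanreal (\<lambda>x. d + (\<Sum>i<n. b i * x i))"
      by (auto simp: powertop_real_euclidean intro!: continuous_intros continuous_on_nth)
    then show "continuous_map (subtopology (Euclidean_space n) U) euclideanreal
        (foldr partial_deriv ds (\<lambda>x. c + (\<Sum>i<n. a i * x i)))"
      unfolding eq by (simp add: Euclidean_space_def continuous_map_from_subtopology)
    show "(\<lambda>t. foldr partial_deriv ds (\<lambda>x. c + (\<Sum>i<n. a i * x i)) (x(j := t))) field_differentiable at (x j)"
      if "j < n" for x j
      unfolding eq field_differentiable_def using D[OF that] by blast
  qed
qed

text \<open>
  The affine simplex is diffeomorphic to Euclidean space, so its identity map is, up to this
  diffeomorphism, a plot. Hence smoothness into a continuous diffeology is plain continuity.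
\<close>

lemma Simp_smooth_sset_continuous:
  "Simp (smooth_sset (continuous_diffeology A)) n =
     {\<sigma> \<in> extensional (affine_simplex n). continuous_map (top_of_set (affine_simplex n)) A \<sigma>}"
proof (intro Set.set_eqI iffI)
  let ?E = "topspace (Euclidean_space n)"
  fix \<sigma> assume "\<sigma> \<in> Simp (smooth_sset (continuous_diffeology A)) n"
  then have \<sigma>: "\<sigma> \<in> smooth_maps (affine_simplex_diffeology n) (continuous_diffeology A)"
    by (simp add: smooth_sset_def)
  \<comment> \<open>the inverse of dropping the last barycentric coordinate\<close>
  define p where "p = (\<lambda>x\<in>?E. \<lambda>i. if i < n then x i else if i = n then 1 - (\<Sum>i<n. x i) else 0)"
  have p_aff: "p x \<in> affine_simplex n" if "x \<in> ?E" for x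
  proof -
    have "(\<Sum>i\<le>n. p x i) = (\<Sum>i<n. p x i) + p x n"
      by (simp flip: lessThan_Suc_atMost)
    also have "\<dots> = 1" using that by (simp add: p_def)
    finally show ?thesis using that by (auto simp: mem_affine_simplex_iff p_def)
  qed
  have sm: "smooth_real n ?E (\<lambda>x. p x j)" if "j \<le> n" for j
  proof (rule smooth_real_sum[where S = "{()}" and g = "\<lambda>_ x. (if j = n then 1 else 0) +
        (\<Sum>i<n. (if j = n then -1 else if i = j then 1 else 0) * x i)"])
    show "openin (Euclidean_space n) ?E" by simp
    show "smooth_real n ?E (\<lambda>x. (if j = n then 1 else 0) +
        (\<Sum>i<n. (if j = n then -1 else if i = j then 1 else 0) * x i))" for a
      by (rule smooth_real_affine)
    show "p x j = (\<Sum>a\<in>{()}. (if j = n then 1 else 0) +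
        (\<Sum>i<n. (if j = n then -1 else if i = j then 1 else 0) * x i))" if "x \<in> ?E" for x
    proof (cases "j = n")
      case True
      then show ?thesis using that by (simp add: p_def sum_negf)
    next
      case False
      have "(\<Sum>i<n. (if i = j then 1 else 0) * x i) = (\<Sum>i<n. if i = j then x i else 0)"
        by (intro sum.cong) auto
      then show ?thesis using that False \<open>j \<le> n\<close> by (simp add: p_def)
    qed
  qed auto
  have "p \<in> Plots (affine_simplex_diffeology n) n ?E"
    using sm p_aff
    by (auto simp: affine_simplex_diffeology_def sub_diffeology_def euclidean_diffeology_def
        smooth_euclidean_def less_Suc_eq_le p_def affine_simplex_def)
  then have "compose ?E \<sigma> p \<in> Plots (continuous_diffeology A) n ?E"
    using \<sigma> openin_topspace unfolding smooth_maps_def by blast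
  then have c: "continuous_map (top_of_set ?E) A (compose ?E \<sigma> p)"
    unfolding subtopology_Euclidean_space[OF subset_refl, symmetric]
    by (simp add: continuous_diffeology_def)
  define q where "q x = (\<lambda>i. if i < n then x i else 0)" for x :: "nat \<Rightarrow> real"
  have "continuous_on (affine_simplex n) q"
    unfolding q_def
  proof (rule continuous_on_coordinatewise_then_product)
    show "continuous_on (affine_simplex n) (\<lambda>x. if i < n then x i else 0)" for i
      by (cases "i < n") (simp_all add: continuous_on_nth)
  qed
  then have "continuous_map (top_of_set (affine_simplex n)) (top_of_set ?E) q"
    by (auto simp: q_def topspace_Euclidean_space)
  then have "continuous_map (top_of_set (affine_simplex n)) A (compose ?E \<sigma> p \<circ> q)"
    using c by (rule continuous_map_compose)
  moreover have "(compose ?E \<sigma> p \<circ> q) y = \<sigma> y" if "y \<in> affine_simplex n" for y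
  proof -
    have qE: "q y \<in> ?E" by (auto simp: q_def topspace_Euclidean_space)
    have "(\<Sum>i<n. q y i) = (\<Sum>i<n. y i)" by (auto simp: q_def)
    moreover have "(\<Sum>i\<le>n. y i) = (\<Sum>i<n. y i) + y n"
      by (simp flip: lessThan_Suc_atMost)
    ultimately have "p (q y) = y"
      using that qE by (auto simp: p_def fun_eq_iff mem_affine_simplex_iff) (auto simp: q_def)
    then show ?thesis using qE by (simp add: compose_def)
  qed
  ultimately have "continuous_map (top_of_set (affine_simplex n)) A \<sigma>"
    by (rule continuous_map_eq) simp
  then show "\<sigma> \<in> {\<sigma> \<in> extensional (affine_simplex n). continuous_map (top_of_set (affine_simplex n)) A \<sigma>}"
    using \<sigma> by (auto simp: smooth_maps_def PiE_def)
next
  fix \<sigma> assume "\<sigma> \<in> {\<sigma> \<in> extensional (affine_simplex n). continuous_map (top_of_set (affine_simplex n)) A \<sigma>}"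
  then have \<sigma>: "\<sigma> \<in> extensional (affine_simplex n)" "continuous_map (top_of_set (affine_simplex n)) A \<sigma>"
    by auto
  have "compose U \<sigma> p \<in> Plots (continuous_diffeology A) k U"
    if U: "openin (Euclidean_space k) U" and p: "p \<in> Plots (affine_simplex_diffeology n) k U" for k U p
  proof -
    have sub: "affine_simplex n \<subseteq> topspace (Euclidean_space (Suc n))"
      by (auto simp: affine_simplex_def)
    have "smooth_euclidean k U (Suc n) (affine_simplex n) p"
      using p by (auto simp: affine_simplex_diffeology_def sub_diffeology_def euclidean_diffeology_def
          smooth_euclidean_def)
    then have "continuous_map (subtopology (Euclidean_space k) U) (top_of_set (affine_simplex n)) p"
      using smooth_euclidean_continuous[OF _ sub] by (simp add: subtopology_Euclidean_space[OF sub])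
    then have "continuous_map (subtopology (Euclidean_space k) U) A (\<sigma> \<circ> p)"
      using \<sigma>(2) by (rule continuous_map_compose)
    then have "continuous_map (subtopology (Euclidean_space k) U) A (compose U \<sigma> p)"
      by (rule continuous_map_eq) (auto simp: compose_def)
    then show ?thesis by (simp add: continuous_diffeology_def)
  qed
  moreover have "\<sigma> \<in> affine_simplex n \<rightarrow>\<^sub>E Points (continuous_diffeology A)"
    using \<sigma> by (auto simp: continuous_diffeology_def PiE_def continuous_map_def)
  ultimately show "\<sigma> \<in> Simp (smooth_sset (continuous_diffeology A)) n"
    by (simp add: smooth_sset_def smooth_maps_def)
qed

lemma Simp_singular_sset:
  "Simp (singular_sset A) n =
     {\<sigma> \<in> extensional (standard_simplex n). continuous_map (top_of_set (standard_simplex n)) A \<sigma>}"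
  by (auto simp: singular_sset_def singular_simplex_def powertop_real_euclidean)

lemma Act_smooth_sset: "Act (smooth_sset X) n m f \<sigma> = compose (affine_simplex n) \<sigma> (push n f)"
  by (simp add: smooth_sset_def)

lemma Act_singular_sset: "Act (singular_sset A) n m f \<sigma> = compose (standard_simplex n) \<sigma> (push n f)"
  by (simp add: singular_sset_def)

section \<open>The category of finite ordinals and minimal representations of simplices\<close>

lemma DeltaI:
  assumes "\<And>i. i \<le> n \<Longrightarrow> f i \<le> m" "\<And>i j. i \<le> j \<Longrightarrow> j \<le> n \<Longrightarrow> f i \<le> f j"
    "f \<in> extensional {..n}"
  shows "f \<in> Delta n m"
  using assms by (auto simp: Delta_def mono_on_def PiE_iff)

lemma Delta_le: "f \<in> Delta n m \<Longrightarrow> i \<le> n \<Longrightarrow> f i \<le> m"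
  by (auto simp: Delta_def)

lemma Delta_mono: "f \<in> Delta n m \<Longrightarrow> i \<le> j \<Longrightarrow> j \<le> n \<Longrightarrow> f i \<le> f j"
  by (auto simp: Delta_def mono_on_def)

lemma Delta_compose:
  assumes "f \<in> Delta n m" "g \<in> Delta m k"
  shows "compose {..n} g f \<in> Delta n k"
  by (rule DeltaI) (use assms in \<open>simp_all add: compose_def Delta_le Delta_mono\<close>)

text \<open>The injection $[n] \to [n+1]$ that misses \<open>j\<close>.\<close>

definition coface :: "nat \<Rightarrow> nat \<Rightarrow> nat \<Rightarrow> nat" where
  "coface n j = (\<lambda>i\<in>{..n}. if i < j then i else Suc i)"

text \<open>
  The surjection $[n+1] \to [n]$ that identifies \<open>j\<close> with \<open>j - 1\<close>, for \<open>j = 0\<close> with 1. Indexing it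
  by the vertex \<open>j\<close> to be dropped, with the last vertex allowed, makes it a left inverse of
  \<open>coface n j\<close> for each \<open>j\<close>.
\<close>

definition codegeneracy :: "nat \<Rightarrow> nat \<Rightarrow> nat \<Rightarrow> nat" where
  "codegeneracy n j = (\<lambda>i\<in>{..Suc n}. if i < j then i else i - 1)"

lemma coface_Delta: "coface n j \<in> Delta n (Suc n)"
  by (auto simp: coface_def Delta_def mono_on_def)

lemma codegeneracy_Delta: "j \<le> Suc n \<Longrightarrow> codegeneracy n j \<in> Delta (Suc n) n"
  by (auto simp: codegeneracy_def Delta_def mono_on_def)

lemma Delta_eqI:
  assumes "f \<in> Delta n m" "g \<in> Delta n k" "\<And>i. i \<le> n \<Longrightarrow> f i = g i"
  shows "f = g"
  using assms by (intro extensionalityI[of f "{..n}"]) (auto simp: Delta_def PiE_def)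

lemma Delta_factor:
  assumes f: "f \<in> Delta n (Suc m)" and j: "j \<le> Suc m" and miss: "j \<notin> f ` {..n}"
  shows "compose {..n} (coface m j) (compose {..n} (codegeneracy m j) f) = f"
proof (rule Delta_eqI[OF _ f])
  show "compose {..n} (coface m j) (compose {..n} (codegeneracy m j) f) \<in> Delta n (Suc m)"
    by (intro Delta_compose[OF _ coface_Delta] Delta_compose[OF f] codegeneracy_Delta j)
  fix i assume i: "i \<le> n"
  then have "f i \<noteq> j" "f i \<le> Suc m" using miss Delta_le[OF f] by auto
  then show "compose {..n} (coface m j) (compose {..n} (codegeneracy m j) f) i = f i"
    using i j by (auto simp: compose_def coface_def codegeneracy_def)
qed

text \<open>
  A surjection has sections through any prescribed point. This lets a surjection be recovered
  from its sections.
\<close>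

lemma Delta_section:
  assumes f: "f \<in> Delta n m" and surj: "f ` {..n} = {..m}" and i0: "i0 \<le> n"
  obtains g where "g \<in> Delta m n" "\<And>j. j \<le> m \<Longrightarrow> f (g j) = j" "g (f i0) = i0"
proof -
  define g where "g = (\<lambda>j\<in>{..m}. if j = f i0 then i0 else (LEAST i. i \<le> n \<and> f i = j))"
  have L: "(LEAST i. i \<le> n \<and> f i = j) \<le> n \<and> f (LEAST i. i \<le> n \<and> f i = j) = j" if "j \<le> m" for j
  proof -
    have "\<exists>i. i \<le> n \<and> f i = j" using surj that by (metis atMost_iff imageE)
    then show ?thesis by (rule LeastI_ex)
  qed
  have g: "g j \<le> n" "f (g j) = j" if "j \<le> m" for j
    using L[OF that] i0 that by (auto simp: g_def)
  have "g j \<le> g j'" if "j \<le> j'" "j' \<le> m" for j j'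
  proof (cases "j = j'")
    case False
    show ?thesis
    proof (rule ccontr)
      assume "\<not> g j \<le> g j'"
      then have "f (g j') \<le> f (g j)" using Delta_mono[OF f, of "g j'" "g j"] g[of j] that by auto
      then show False using g[of j] g[of j'] that False by auto
    qed
  qed auto
  then have "g \<in> Delta m n"
    using g by (intro DeltaI) (auto simp: g_def)
  moreover have "g (f i0) = i0" using Delta_le[OF f i0] by (simp add: g_def)
  ultimately show ?thesis using that g(2) by blast
qed

lemma Delta_surj_self:
  assumes f: "f \<in> Delta n n" and surj: "f ` {..n} = {..n}"
  shows "f = (\<lambda>i\<in>{..n}. i)"
proof -
  have inj: "inj_on f {..n}" using surj by (simp add: eq_card_imp_inj_on)
  have lt: "f i < f j" if "i < j" "j \<le> n" for i j
  proof -
    have "f i \<noteq> f j" using inj that by (auto simp: inj_on_def)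
    then show ?thesis using Delta_mono[OF f, of i j] that by auto
  qed
  have ge: "i \<le> f i" if "i \<le> n" for i
    using that
  proof (induction i)
    case (Suc i)
    then show ?case using lt[of i "Suc i"] by simp
  qed simp
  have le: "f (n - k) \<le> n - k" if "k \<le> n" for k
    using that
  proof (induction k)
    case 0
    show ?case using Delta_le[OF f, of n] by simp
  next
    case (Suc k)
    then show ?case using lt[of "n - Suc k" "n - k"] by linarith
  qed
  have "f i = i" if "i \<le> n" for i
    using ge[OF that] le[of "n - i"] that by simp
  then show ?thesis
    by (intro Delta_eqI[OF f, of _ n]) (auto simp: Delta_def mono_on_def)
qed

lemma simplicial_set_Act:
  assumes "simplicial_set X" "f \<in> Delta n m" "x \<in> Simp X m"
  shows "Act X n m f x \<in> Simp X n"
  using assms unfolding simplicial_set_def by blast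

lemma simplicial_set_Act_compose:
  assumes "simplicial_set X" "f \<in> Delta n m" "g \<in> Delta m k" "x \<in> Simp X k"
  shows "Act X n k (compose {..n} g f) x = Act X n m f (Act X m k g x)"
  using assms unfolding simplicial_set_def by blast

lemma simplicial_set_Act_id:
  assumes "simplicial_set X" "x \<in> Simp X n"
  shows "Act X n n (\<lambda>i\<in>{..n}. i) x = x"
  using assms unfolding simplicial_set_def by blast

lemma Delta_id: "(\<lambda>i\<in>{..n}. i) \<in> Delta n n"
  by (auto simp: Delta_def mono_on_def)

text \<open>
  The minimal dimension of a simplex from which the \<open>n\<close>-simplex \<open>x\<close> can be pulled back; \<open>x\<close> is
  nondegenerate if and only if it equals \<open>n\<close>.
\<close>

definition essential_dim :: "'x sset \<Rightarrow> nat \<Rightarrow> 'x \<Rightarrow> nat" where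
  "essential_dim X n x = (LEAST m. \<exists>f\<in>Delta n m. \<exists>z\<in>Simp X m. x = Act X n m f z)"

lemma essential_rep:
  assumes X: "simplicial_set X" and x: "x \<in> Simp X n"
  obtains f z where "f \<in> Delta n (essential_dim X n x)" "z \<in> Simp X (essential_dim X n x)"
    "x = Act X n (essential_dim X n x) f z"
proof -
  have "\<exists>m. \<exists>f\<in>Delta n m. \<exists>z\<in>Simp X m. x = Act X n m f z"
    by (intro exI[of _ n] bexI[OF _ Delta_id] bexI[OF _ x]) (simp add: simplicial_set_Act_id[OF X x])
  then have "\<exists>f\<in>Delta n (essential_dim X n x). \<exists>z\<in>Simp X (essential_dim X n x).
      x = Act X n (essential_dim X n x) f z"
    unfolding essential_dim_def by (rule LeastI_ex)
  then show ?thesis using that by blast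
qed

lemma essential_dim_le:
  assumes "f \<in> Delta n m" "z \<in> Simp X m" "x = Act X n m f z"
  shows "essential_dim X n x \<le> m"
  unfolding essential_dim_def using assms by (intro Least_le) blast

lemma essential_dim_le_self:
  assumes X: "simplicial_set X" and x: "x \<in> Simp X n"
  shows "essential_dim X n x \<le> n"
  using essential_dim_le[OF Delta_id x] simplicial_set_Act_id[OF X x] by simp

lemma essential_surj:
  assumes X: "simplicial_set X" and m: "m = essential_dim X n x"
    and f: "f \<in> Delta n m" and z: "z \<in> Simp X m" and x: "x = Act X n m f z"
  shows "f ` {..n} = {..m}"
proof (rule ccontr)
  assume "f ` {..n} \<noteq> {..m}"
  then obtain j where j: "j \<le> m" "j \<notin> f ` {..n}" using Delta_le[OF f] by auto
  have "m \<noteq> 0" using j Delta_le[OF f, of 0] by force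
  then obtain k where k: "m = Suc k" by (cases m) auto
  let ?g = "compose {..n} (codegeneracy k j) f"
  have g: "?g \<in> Delta n k"
    using f j k by (intro Delta_compose[OF _ codegeneracy_Delta]) auto
  have "x = Act X n (Suc k) (compose {..n} (coface k j) ?g) z"
    using Delta_factor[of f n k j] f j unfolding x k by simp
  also have "\<dots> = Act X n k ?g (Act X k (Suc k) (coface k j) z)"
    using z k by (intro simplicial_set_Act_compose[OF X g coface_Delta]) simp
  finally have "essential_dim X n x \<le> k"
    using z k by (intro essential_dim_le[OF g simplicial_set_Act[OF X coface_Delta]]) auto
  then show False using k m by simp
qed

text \<open>
  The uniqueness part of the Eilenberg--Zilber lemma: a section \<open>g\<close> of \<open>f\<close> turns the second
  representation into \<open>z = (f' g)\<^sup>* z'\<close>, and minimality forces \<open>f' g\<close> to be the identity.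
\<close>

lemma essential_rep_unique:
  assumes X: "simplicial_set X" and m: "m = essential_dim X n x"
    and f: "f \<in> Delta n m" "z \<in> Simp X m" "x = Act X n m f z"
    and f': "f' \<in> Delta n m" "z' \<in> Simp X m" "x = Act X n m f' z'"
  shows "f' = f" "z' = z"
proof -
  have sf: "f ` {..n} = {..m}" by (rule essential_surj[OF X m f])
  have id: "compose {..m} f' g = (\<lambda>i\<in>{..m}. i) \<and> z = Act X m m (compose {..m} f' g) z'"
    if g: "g \<in> Delta m n" "\<And>j. j \<le> m \<Longrightarrow> f (g j) = j" for g
  proof -
    let ?h = "compose {..m} f' g"
    have h: "?h \<in> Delta m m" by (rule Delta_compose[OF g(1) f'(1)])
    have fg: "compose {..m} f g = (\<lambda>i\<in>{..m}. i)" using g(2) by (auto simp: compose_def)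
    have "z = Act X m m (compose {..m} f g) z" using simplicial_set_Act_id[OF X f(2)] fg by simp
    also have "\<dots> = Act X m n g x"
      using simplicial_set_Act_compose[OF X g(1) f(1,2)] f(3) by simp
    also have "\<dots> = Act X m m ?h z'"
      using simplicial_set_Act_compose[OF X g(1) f'(1,2)] f'(3) by simp
    finally have z: "z = Act X m m ?h z'" .
    have hf: "compose {..n} ?h f \<in> Delta n m" by (rule Delta_compose[OF f(1) h])
    have "x = Act X n m (compose {..n} ?h f) z'"
      using simplicial_set_Act_compose[OF X f(1) h f'(2)] f(3) z by simp
    then have "compose {..n} ?h f ` {..n} = {..m}"
      by (rule essential_surj[OF X m hf f'(2)])
    moreover have "compose {..n} ?h f ` {..n} = ?h ` {..m}"
      by (simp add: compose_def image_image flip: sf)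
    ultimately have "?h = (\<lambda>i\<in>{..m}. i)" by (intro Delta_surj_self[OF h]) auto
    then show ?thesis using z by simp
  qed
  obtain g where g: "g \<in> Delta m n" "\<And>j. j \<le> m \<Longrightarrow> f (g j) = j"
    using Delta_section[OF f(1) sf, of 0] by auto
  show "z' = z" using id[OF g] simplicial_set_Act_id[OF X f'(2)] by metis
  show "f' = f"
  proof (rule Delta_eqI[OF f'(1) f(1)])
    fix i assume i: "i \<le> n"
    obtain g where g: "g \<in> Delta m n" "\<And>j. j \<le> m \<Longrightarrow> f (g j) = j" "g (f i) = i"
      using Delta_section[OF f(1) sf i] by auto
    have "compose {..m} f' g (f i) = f i" using id[OF g(1,2)] Delta_le[OF f(1) i] by auto
    then show "f' i = f i" using g(3) Delta_le[OF f(1) i] by (simp add: compose_def)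
  qed
qed

section \<open>Retracting the affine simplex onto its boundary and the standard simplex\<close>

lemma continuous_on_fst_nth: "continuous_on S (\<lambda>p::(nat \<Rightarrow> real) \<times> real. fst p i)"
  by (rule continuous_on_compose2[OF continuous_on_nth[of UNIV i] continuous_on_fst]) auto

lemma continuous_on_Min:
  fixes f :: "'i \<Rightarrow> 'x::topological_space \<Rightarrow> real"
  assumes "finite I" "I \<noteq> {}" "\<And>i. i \<in> I \<Longrightarrow> continuous_on S (f i)"
  shows "continuous_on S (\<lambda>x. Min ((\<lambda>i. f i x) ` I))"
  using assms
proof (induction I rule: finite_ne_induct)
  case (insert i I)
  then show ?case by (auto simp: intro!: continuous_on_min)
qed auto

text \<open>
  The subset of \<open>affine_simplex n \<times> T\<close>, with \<open>T\<close> a subset of $[-1,1]$, over which natural families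
  will be prescribed: the standard simplex, and the ends $\pm 1$ as far as they belong to \<open>T\<close>.
\<close>

definition prescribed :: "nat \<Rightarrow> real set \<Rightarrow> ((nat \<Rightarrow> real) \<times> real) set" where
  "prescribed n T = {(y, u). y \<in> affine_simplex n \<and> u \<in> T \<and> (y \<in> standard_simplex n \<or> \<bar>u\<bar> = 1)}"

text \<open>
  On the region where the coordinates in \<open>I\<close> are nonpositive and the others nonnegative, the retraction moves \<open>y\<close> at
  constant speed in the direction that raises each coordinate in \<open>I\<close> by \<open>1 / card I\<close> and
  lowers each of the others by \<open>1 / card J\<close>, with \<open>J\<close> the complement of \<open>I\<close>; this keeps the sum of the
  coordinates. After time \<open>t I y\<close> a coordinate vanishes. Meanwhile \<open>u\<close> is scaled by \<open>1 + time\<close>, and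
  the motion stops as soon as \<open>y\<close> meets a hyperplane or \<open>u\<close> meets $\pm 1$. Scaling, rather than
  moving \<open>u\<close> at constant speed, keeps this continuous at \<open>u = 0\<close>; it is also what lets the
  singleton \<open>T = {0}\<close> be treated as the same case. The second hypothesis on \<open>T\<close> says that \<open>T\<close>
  contains all rescalings in $[-1,1]$ of its points.
\<close>

lemma affine_simplex_retract:
  assumes T1: "T \<subseteq> {-1..1}" and Tc: "\<And>u c. u \<in> T \<Longrightarrow> \<bar>c * u\<bar> \<le> 1 \<Longrightarrow> c * u \<in> T"
  shows "{(y, u) \<in> affine_simplex n \<times> T. \<exists>j\<le>n. y j = 0} \<union> prescribed n T
           retract_of (affine_simplex n \<times> T)"
proof -
  let ?E = "affine_simplex n \<times> T"
  let ?B = "{(y, u) \<in> affine_simplex n \<times> T. \<exists>j\<le>n. y j = 0} \<union> prescribed n T"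
  define C where "C I = {p \<in> ?E. \<forall>i\<le>n. if i \<in> I then fst p i \<le> 0 else 0 \<le> fst p i}" for I
  define c where "c I i = real (if i \<in> I then card I else card ({..n} - I))" for I and i :: nat
  define sg where "sg I i = (if i \<in> I then -1 else 1 :: real)" for I and i :: nat
  define t where "t I y = (if I = {} then 0 else Min ((\<lambda>i. c I i * \<bar>y i\<bar>) ` {..n}))" for I and y :: "nat \<Rightarrow> real"
  \<comment> \<open>one plus the stopping time, that is, the minimum of 1 + t and 1 / abs u\<close>
  define l where "l I p = 1 / max \<bar>snd p\<bar> (1 / (1 + t I (fst p)))" for I and p :: "(nat \<Rightarrow> real) \<times> real"
  define f where "f I p = ((\<lambda>i. fst p i - (l I p - 1) * (if i \<le> n then sg I i / c I i else 0)), l I p * snd p)"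
    for I and p :: "(nat \<Rightarrow> real) \<times> real"
  have c0: "0 \<le> c I i" for I i by (simp add: c_def)
  have cpos: "0 < c I i" if "I \<subseteq> {..n}" "i \<le> n" for I i
    using that finite_subset[of I "{..n}"] by (auto simp: c_def card_gt_0_iff)
  have t0: "0 \<le> t I y" for I y
    by (auto simp: t_def c0)
  have t_eq0: "t I y = 0" if "j \<le> n" "y j = 0" for I y j
  proof -
    have "Min ((\<lambda>i. c I i * \<bar>y i\<bar>) ` {..n}) \<le> c I j * \<bar>y j\<bar>"
      using that by (intro Min_le) auto
    then show ?thesis using that t0[of I y] by (auto simp: t_def split: if_splits)
  qed
  have l1: "l I p = 1" if "\<bar>snd p\<bar> \<le> 1" "t I (fst p) = 0 \<or> \<bar>snd p\<bar> = 1" for I p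
    using that t0[of I "fst p"] by (auto simp: l_def max_def)
  \<comment> \<open>the regions overlap where some coordinate vanishes, and there all pieces are the identity\<close>
  have f_id: "f I p = p" if "p \<in> ?E" "t I (fst p) = 0 \<or> \<bar>snd p\<bar> = 1" for I p
    using l1[of p I] that T1 by (auto simp: f_def abs_le_iff)
  have E: "p \<in> C {i. i \<le> n \<and> fst p i \<le> 0}" if "p \<in> ?E" for p
    using that by (auto simp: C_def)
  have t_contI: "continuous_on ?E (\<lambda>p. t I (fst p))" for I
  proof (cases "I = {}")
    case False
    have "continuous_on ?E (\<lambda>p. Min ((\<lambda>i. c I i * \<bar>fst p i\<bar>) ` {..n}))"
      by (rule continuous_on_Min) (auto intro!: continuous_intros continuous_on_fst_nth)
    then show ?thesis using False by (simp add: t_def)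
  qed (simp add: t_def)
  have l_cont: "continuous_on ?E (l I)" for I
  proof -
    have pos: "0 < 1 + t I (fst p)" for p :: "(nat \<Rightarrow> real) \<times> real"
      using t0[of I "fst p"] by simp
    have "continuous_on ?E (\<lambda>p. max \<bar>snd p\<bar> (1 / (1 + t I (fst p))))"
      using pos by (intro continuous_intros continuous_on_max t_contI) (metis less_irrefl)
    moreover have "max \<bar>snd p\<bar> (1 / (1 + t I (fst p))) \<noteq> 0" for p
      using pos[of p] by (metis divide_pos_pos less_irrefl less_max_iff_disj zero_less_one)
    ultimately show ?thesis
      unfolding l_def by (intro continuous_on_divide continuous_on_const) auto
  qed
  have f_cont: "continuous_on ?E (f I)" for I
    unfolding f_def
    by (intro continuous_on_Pair continuous_on_coordinatewise_then_product continuous_intros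
        l_cont continuous_on_fst_nth)
  have f_B: "f I p \<in> ?B" if I: "I \<subseteq> {..n}" and p: "p \<in> C I" for I p
  proof (cases "I = {}")
    case True
    then have "f I p = p" using p by (intro f_id) (auto simp: C_def t_def)
    moreover have "fst p \<in> standard_simplex n"
      using p True by (auto simp: C_def standard_simplex_eq mem_affine_simplex_iff)
        (metis le_less_linear order_refl)
    ultimately show ?thesis using p by (auto simp: prescribed_def C_def)
  next
    case False
    obtain y u where yu: "p = (y, u)" by fastforce
    let ?t = "t I y" and ?l = "l I p" and ?J = "{..n} - I"
    have y: "y \<in> affine_simplex n" and u: "u \<in> T" using p yu by (auto simp: C_def)
    have J: "?J \<noteq> {}"
    proof
      assume "?J = {}"
      then have "(\<Sum>i\<le>n. y i) \<le> 0" using p yu I by (intro sum_nonpos) (auto simp: C_def)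
      then show False using y by (simp add: mem_affine_simplex_iff)
    qed
    have fin: "finite I" using I finite_subset by blast
    have "(\<Sum>i\<le>n. sg I i / c I i) = (\<Sum>i\<in>I. sg I i / c I i) + (\<Sum>i\<in>?J. sg I i / c I i)"
      using I by (simp add: sum.subset_diff add.commute)
    also have "(\<Sum>i\<in>I. sg I i / c I i) = (\<Sum>i\<in>I. -1 / real (card I))"
      by (intro sum.cong) (auto simp: sg_def c_def)
    also have "(\<Sum>i\<in>?J. sg I i / c I i) = (\<Sum>i\<in>?J. 1 / real (card ?J))"
      by (intro sum.cong) (auto simp: sg_def c_def)
    finally have "(\<Sum>i\<le>n. sg I i / c I i) = 0"
      using False J fin by simp
    then have "(\<Sum>i\<le>n. (?l - 1) * (sg I i / c I i)) = 0"
      by (simp only: mult_zero_right flip: sum_distrib_left)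
    then have aff: "fst (f I p) \<in> affine_simplex n"
      using y by (simp add: f_def yu mem_affine_simplex_iff sum_subtractf)
    have mpos: "0 < max \<bar>u\<bar> (1 / (1 + ?t))" using t0[of I y] by (simp add: less_max_iff_disj)
    have "\<bar>?l * u\<bar> \<le> 1"
      using mpos by (simp add: l_def yu abs_mult divide_le_eq)
    then have fT: "snd (f I p) \<in> T" using Tc[OF u, of ?l] by (simp add: f_def yu)
    show ?thesis
    proof (cases "\<bar>u\<bar> \<le> 1 / (1 + ?t)")
      case True
      then have l: "?l = 1 + ?t" by (simp add: l_def yu max_def)
      have "Min ((\<lambda>i. c I i * \<bar>y i\<bar>) ` {..n}) \<in> (\<lambda>i. c I i * \<bar>y i\<bar>) ` {..n}"
        by (rule Min_in) auto
      then obtain i where "i \<le> n" "Min ((\<lambda>i. c I i * \<bar>y i\<bar>) ` {..n}) = c I i * \<bar>y i\<bar>"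
        by (metis (no_types, lifting) atMost_iff imageE)
      then have i: "i \<le> n" "?t = c I i * \<bar>y i\<bar>"
        using \<open>I \<noteq> {}\<close> by (simp_all add: t_def)
      have "y i = \<bar>y i\<bar> * sg I i" using p i yu by (auto simp: C_def sg_def)
      then have "fst (f I p) i = 0" using i cpos[OF I i(1)] l by (simp add: f_def yu)
      then show ?thesis using aff fT i(1) by (auto simp: mem_Times_iff case_prod_beta)
    next
      case False
      then have "\<bar>?l * u\<bar> = 1" using mpos by (simp add: l_def yu max_def abs_mult)
      then have "\<bar>snd (f I p)\<bar> = 1" by (simp add: f_def yu)
      then show ?thesis using aff fT by (auto simp: prescribed_def case_prod_beta)
    qed
  qed
  obtain r where r: "continuous_map (top_of_set ?E) euclidean r"
    and rf: "\<And>p I. I \<in> Pow {..n} \<Longrightarrow> p \<in> topspace (top_of_set ?E) \<inter> C I \<Longrightarrow> r p = f I p"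
  proof (rule pasting_lemma_exists_closed[of "Pow {..n}" "top_of_set ?E" C euclidean f])
    show "topspace (top_of_set ?E) \<subseteq> \<Union> (C ` Pow {..n})" using E by fastforce
    show "closedin (top_of_set ?E) (C I)" for I
    proof -
      have "closed {p::(nat \<Rightarrow> real) \<times> real. \<forall>i\<le>n. if i \<in> I then fst p i \<le> 0 else 0 \<le> fst p i}"
      proof (intro closed_Collect_all closed_Collect_imp)
        fix i :: nat
        have "closed {p::(nat \<Rightarrow> real) \<times> real. fst p i \<le> 0}" "closed {p::(nat \<Rightarrow> real) \<times> real. 0 \<le> fst p i}"
          by (intro closed_Collect_le continuous_on_const continuous_on_fst_nth)+
        then show "closed {p::(nat \<Rightarrow> real) \<times> real. if i \<in> I then fst p i \<le> 0 else 0 \<le> fst p i}"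
          by (cases "i \<in> I") simp_all
      qed auto
      moreover have "C I = ?E \<inter> {p. \<forall>i\<le>n. if i \<in> I then fst p i \<le> 0 else 0 \<le> fst p i}"
        by (auto simp: C_def)
      ultimately show ?thesis by (simp add: closedin_closed_Int)
    qed
    show "continuous_map (subtopology (top_of_set ?E) (C I)) euclidean (f I)" for I
      using continuous_on_subset[OF f_cont[of I]] by (simp add: subtopology_subtopology)
    show "f I p = f I' p" if "I \<in> Pow {..n}" "I' \<in> Pow {..n}" "p \<in> topspace (top_of_set ?E) \<inter> C I \<inter> C I'" for I I' p
    proof (cases "I = I'")
      case False
      then obtain i where ii: "i \<in> I \<longleftrightarrow> i \<notin> I'" by blast
      then have i: "i \<le> n" using that(1,2) by auto
      have "p \<in> C I" "p \<in> C I'" using that(3) by auto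
      then have "fst p i = 0" using ii i unfolding C_def by (metis (mono_tags, lifting) mem_Collect_eq order_antisym)
      then show ?thesis using f_id[of p] t_eq0[OF i(1)] that(3) by simp
    qed simp
  qed auto
  have rE: "r p \<in> ?B" if "p \<in> ?E" for p
  proof -
    let ?I = "{i. i \<le> n \<and> fst p i \<le> 0}"
    have I: "?I \<subseteq> {..n}" by auto
    have "r p = f ?I p" using I E[OF that] that by (intro rf) auto
    then show ?thesis using f_B[OF I E[OF that]] by (rule ssubst)
  qed
  have r_id: "r p = p" if p: "p \<in> ?B" for p
  proof -
    have pE: "p \<in> ?E" using p by (auto simp: prescribed_def)
    have "fst p \<in> standard_simplex n \<or> (\<exists>j\<le>n. fst p j = 0) \<or> \<bar>snd p\<bar> = 1"
      using p by (auto simp: prescribed_def)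
    then consider "fst p \<in> standard_simplex n" | "(\<exists>j\<le>n. fst p j = 0) \<or> \<bar>snd p\<bar> = 1"
      by blast
    then show ?thesis
    proof cases
      case 1
      then have "p \<in> C {}" using pE by (auto simp: C_def standard_simplex_eq)
      then show ?thesis using rf[of "{}" p] f_id[OF pE, of "{}"] pE by (simp add: t_def)
    next
      case 2
      let ?I = "{i. i \<le> n \<and> fst p i \<le> 0}"
      have "f ?I p = p" using 2 t_eq0 by (intro f_id[OF pE]) blast
      then show ?thesis using rf[of ?I p] E[OF pE] pE by auto
    qed
  qed
  have "retraction ?E ?B r"
    unfolding retraction_def using r rE r_id by (auto simp: prescribed_def)
  then show ?thesis unfolding retract_of_def by blast
qed

section \<open>Extending natural families from the standard to the affine simplices\<close>

text \<open>The map $f_* \times \mathrm{id}$ on the cylinders \<open>affine_simplex n \<times> T\<close>.\<close>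

definition cpush :: "nat \<Rightarrow> (nat \<Rightarrow> nat) \<Rightarrow> (nat \<Rightarrow> real) \<times> real \<Rightarrow> (nat \<Rightarrow> real) \<times> real" where
  "cpush n f p = (push n f (fst p), snd p)"

lemma cpush_compose:
  "f \<in> Delta n m \<Longrightarrow> cpush n (compose {..n} g f) p = cpush m g (cpush n f p)"
  by (simp add: cpush_def push_compose)

lemma cpush_id: "p \<in> affine_simplex n \<times> T \<Longrightarrow> cpush n (\<lambda>i\<in>{..n}. i) p = p"
  by (auto simp: cpush_def push_id mem_affine_simplex_iff)

lemma cpush_affine:
  "f \<in> Delta n m \<Longrightarrow> p \<in> affine_simplex n \<times> T \<Longrightarrow> cpush n f p \<in> affine_simplex m \<times> T"
  by (auto simp: cpush_def push_affine_simplex)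

lemma cpush_prescribed:
  "f \<in> Delta n m \<Longrightarrow> p \<in> prescribed n T \<Longrightarrow> cpush n f p \<in> prescribed m T"
  by (auto simp: cpush_def prescribed_def push_affine_simplex push_standard_simplex)

lemma prescribed_subset: "prescribed n T \<subseteq> affine_simplex n \<times> T"
  by (auto simp: prescribed_def)

lemma continuous_on_cpush: "continuous_on S (cpush n f)"
  unfolding cpush_def push_def
  by (intro continuous_on_Pair continuous_on_coordinatewise_then_product continuous_on_sum
      continuous_on_fst_nth continuous_on_snd continuous_on_id)

lemma continuous_map_cpush:
  assumes f: "f \<in> Delta n m" and S: "S \<subseteq> affine_simplex n \<times> T"
    and h: "continuous_map (top_of_set (affine_simplex m \<times> T)) A h"
  shows "continuous_map (top_of_set S) A (\<lambda>p. h (cpush n f p))"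
proof -
  have "continuous_map (top_of_set S) (top_of_set (affine_simplex m \<times> T)) (cpush n f)"
    using continuous_on_cpush cpush_affine[OF f] S by auto
  then have "continuous_map (top_of_set S) A (h \<circ> cpush n f)"
    using h by (rule continuous_map_compose)
  then show ?thesis by (simp add: o_def)
qed

lemma codegeneracy_coface: "j \<le> Suc m \<Longrightarrow> compose {..m} (codegeneracy m j) (coface m j) = (\<lambda>i\<in>{..m}. i)"
  by (auto simp: compose_def codegeneracy_def coface_def fun_eq_iff)

lemma push_coface_codegeneracy:
  assumes y: "y \<in> affine_simplex (Suc m)" and j: "j \<le> Suc m" "y j = 0"
  shows "push m (coface m j) (push (Suc m) (codegeneracy m j) y) = y"
proof
  fix k
  let ?c = "compose {..Suc m} (coface m j) (codegeneracy m j)"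
  let ?S = "{i. i \<le> Suc m \<and> ?c i = k}"
  have c: "?c i = i" if "i \<le> Suc m" "i \<noteq> j" for i
    using that j(1) by (auto simp: compose_def coface_def codegeneracy_def)
  have cj: "?c i \<noteq> j" if "i \<le> Suc m" for i
    using that j(1) by (auto simp: compose_def coface_def codegeneracy_def)
  have "push m (coface m j) (push (Suc m) (codegeneracy m j) y) k = sum y ?S"
    using push_compose[OF codegeneracy_Delta[OF j(1)], of "coface m j" y, symmetric]
    by (simp add: push_def[of "Suc m" ?c])
  also have "\<dots> = sum y (?S - {j})"
    using j by (intro sum.mono_neutral_right) auto
  also have "\<dots> = y k"
  proof (cases "k = j \<or> k > Suc m")
    case True
    then have "?S - {j} = {}" using c cj by fastforce
    then have "sum y (?S - {j}) = 0" by (simp only: sum.empty)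
    moreover have "y k = 0" using True j y by (auto simp: mem_affine_simplex_iff)
    ultimately show ?thesis by simp
  next
    case False
    then have "?S - {j} = {k}" using c by fastforce
    then show ?thesis by simp
  qed
  finally show "push m (coface m j) (push (Suc m) (codegeneracy m j) y) k = y k" .
qed

lemma cpush_coface_codegeneracy:
  assumes "p \<in> affine_simplex (Suc m) \<times> T" "j \<le> Suc m" "fst p j = 0"
  shows "cpush m (coface m j) (cpush (Suc m) (codegeneracy m j) p) = p"
  using assms push_coface_codegeneracy by (auto simp: cpush_def)

text \<open>
  A family of maps into \<open>A\<close>, one for each simplex of \<open>X\<close>, given on the prescribed parts of the
  cylinders and natural with respect to the structure maps of \<open>X\<close>.
\<close>

locale extension_problem =
  fixes X :: "'x sset" and A :: "'a topology" and T :: "real set"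
    and g :: "nat \<Rightarrow> 'x \<Rightarrow> (nat \<Rightarrow> real) \<times> real \<Rightarrow> 'a"
  assumes X: "simplicial_set X"
    and T1: "T \<subseteq> {-1..1}" and Tc: "\<And>u c. u \<in> T \<Longrightarrow> \<bar>c * u\<bar> \<le> 1 \<Longrightarrow> c * u \<in> T"
    and g_cont: "\<And>n x. x \<in> Simp X n \<Longrightarrow> continuous_map (top_of_set (prescribed n T)) A (g n x)"
    and g_nat: "\<And>n m f x p. f \<in> Delta n m \<Longrightarrow> x \<in> Simp X m \<Longrightarrow> p \<in> prescribed n T \<Longrightarrow>
        g n (Act X n m f x) p = g m x (cpush n f p)"
begin

abbreviation cyl :: "nat \<Rightarrow> ((nat \<Rightarrow> real) \<times> real) set" where
  "cyl n \<equiv> affine_simplex n \<times> T"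

text \<open>
  A natural continuous extension of the family \<open>g\<close> to the full cylinders over the simplices of
  dimension less than \<open>N\<close>.
\<close>

definition solution_below :: "nat \<Rightarrow> (nat \<Rightarrow> 'x \<Rightarrow> (nat \<Rightarrow> real) \<times> real \<Rightarrow> 'a) \<Rightarrow> bool" where
  "solution_below N h \<longleftrightarrow>
     (\<forall>n<N. \<forall>x\<in>Simp X n. continuous_map (top_of_set (cyl n)) A (h n x) \<and>
        (\<forall>p\<in>prescribed n T. h n x p = g n x p)) \<and>
     (\<forall>n<N. \<forall>m<N. \<forall>f\<in>Delta n m. \<forall>x\<in>Simp X m. \<forall>p\<in>cyl n. h n (Act X n m f x) p = h m x (cpush n f p))"

lemma solution_cont:
  "solution_below N h \<Longrightarrow> n < N \<Longrightarrow> x \<in> Simp X n \<Longrightarrow> continuous_map (top_of_set (cyl n)) A (h n x)"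
  unfolding solution_below_def by blast

lemma solution_ext:
  "solution_below N h \<Longrightarrow> n < N \<Longrightarrow> x \<in> Simp X n \<Longrightarrow> p \<in> prescribed n T \<Longrightarrow> h n x p = g n x p"
  unfolding solution_below_def by blast

lemma solution_nat:
  "solution_below N h \<Longrightarrow> n < N \<Longrightarrow> m < N \<Longrightarrow> f \<in> Delta n m \<Longrightarrow> x \<in> Simp X m \<Longrightarrow> p \<in> cyl n \<Longrightarrow>
    h n (Act X n m f x) p = h m x (cpush n f p)"
  unfolding solution_below_def by blast

text \<open>
  The value at a point of the face \<open>j\<close>, computed from an extension over that face, depends
  only on the restriction to any smaller face \<open>f\<close> that contains the point.
\<close>

lemma face_value:
  assumes h: "solution_below (Suc m) h" and x: "x \<in> Simp X (Suc m)"
    and f: "f \<in> Delta k (Suc m)" "k \<le> m" and j: "j \<le> Suc m" "j \<notin> f ` {..k}" and p: "p \<in> cyl k"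
  shows "h m (Act X m (Suc m) (coface m j) x) (cpush (Suc m) (codegeneracy m j) (cpush k f p)) =
      h k (Act X k (Suc m) f x) p"
proof -
  let ?f = "compose {..k} (codegeneracy m j) f"
  have f': "?f \<in> Delta k m" by (rule Delta_compose[OF f(1) codegeneracy_Delta[OF j(1)]])
  have "h m (Act X m (Suc m) (coface m j) x) (cpush (Suc m) (codegeneracy m j) (cpush k f p)) =
      h m (Act X m (Suc m) (coface m j) x) (cpush k ?f p)"
    using cpush_compose[OF f(1)] by simp
  also have "\<dots> = h k (Act X k m ?f (Act X m (Suc m) (coface m j) x)) p"
    using f' f(2) p simplicial_set_Act[OF X coface_Delta x] by (intro solution_nat[OF h, symmetric]) auto
  also have "\<dots> = h k (Act X k (Suc m) f x) p"
    using simplicial_set_Act_compose[OF X f' coface_Delta[of m j] x] Delta_factor[OF f(1) j] by simp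
  finally show ?thesis .
qed

text \<open>
  Where two coordinates vanish, the values from both faces equal the value on the common
  face of codimension two.
\<close>

lemma boundary_compatible:
  assumes h: "solution_below (Suc m) h" and x: "x \<in> Simp X (Suc m)"
    and p: "p \<in> cyl (Suc m)" and ij: "i < j" "j \<le> Suc m" "fst p i = 0" "fst p j = 0"
  shows "h m (Act X m (Suc m) (coface m i) x) (cpush (Suc m) (codegeneracy m i) p) =
      h m (Act X m (Suc m) (coface m j) x) (cpush (Suc m) (codegeneracy m j) p)"
proof (cases m)
  case 0
  then have "i = 0" "j = Suc 0" using ij by auto
  then have "(\<Sum>a\<le>Suc 0. fst p a) = 0" using ij(3,4) by simp
  moreover have "(\<Sum>a\<le>Suc 0. fst p a) = 1" using p 0 by (auto simp: mem_affine_simplex_iff)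
  ultimately show ?thesis by simp
next
  case (Suc k)
  let ?q = "cpush (Suc m) (codegeneracy m j) p"
  let ?r = "cpush (Suc k) (codegeneracy k i) ?q"
  let ?f = "compose {..k} (coface m j) (coface k i)"
  have q: "?q \<in> cyl m" by (rule cpush_affine[OF codegeneracy_Delta[OF ij(2)] p])
  have r: "?r \<in> cyl k" using q ij Suc by (intro cpush_affine[OF codegeneracy_Delta]) auto
  have f: "?f \<in> Delta k (Suc m)"
    using Delta_compose[OF coface_Delta[of k i] coface_Delta[of "Suc k" j]] Suc by simp
  have sub: "{a. a \<le> Suc m \<and> codegeneracy m j a = i} \<subseteq> {i, j}"
    using ij by (auto simp: codegeneracy_def split: if_splits)
  have "fst ?q i = sum (fst p) {a. a \<le> Suc m \<and> codegeneracy m j a = i}"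
    by (simp add: cpush_def push_def)
  also have "\<dots> = 0"
    using sub ij by (intro sum.neutral) auto
  finally have "cpush k (coface k i) ?r = ?q"
    using q ij Suc by (intro cpush_coface_codegeneracy) auto
  then have pf: "cpush k ?f ?r = p"
    using cpush_compose[OF coface_Delta] cpush_coface_codegeneracy[OF p ij(2,4)] Suc by metis
  have "i \<notin> ?f ` {..k}" "j \<notin> ?f ` {..k}"
    using ij Suc by (auto simp: compose_def coface_def split: if_splits)
  then show ?thesis
    using face_value[OF h x f _ _ _ r, unfolded pf] ij Suc by simp
qed

text \<open>
  The extension over a single simplex, with prescribed values on its faces: the values on the
  faces and on the prescribed part are glued, and composed with the retraction.
\<close>

lemma fill:
  assumes h: "solution_below n h" and x: "x \<in> Simp X n"
  obtains k where "continuous_map (top_of_set (cyl n)) A k"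
    "\<And>p. p \<in> prescribed n T \<Longrightarrow> k p = g n x p"
    "\<And>m j p. n = Suc m \<Longrightarrow> j \<le> n \<Longrightarrow> p \<in> cyl m \<Longrightarrow>
        k (cpush m (coface m j) p) = h m (Act X m n (coface m j) x) p"
proof (cases n)
  case 0
  have "0 \<le> y i" if "y 0 = 1" "\<forall>i>0. y i = 0" for y :: "nat \<Rightarrow> real" and i
    using that by (cases i) auto
  then have "prescribed 0 T = cyl 0"
    by (auto simp: prescribed_def standard_simplex_eq mem_affine_simplex_iff)
  then show ?thesis using that[of "g 0 x"] g_cont[OF x] 0 by auto
next
  case (Suc m)
  let ?B = "{(y, u) \<in> cyl n. \<exists>j\<le>n. y j = 0} \<union> prescribed n T"
  have BE: "?B \<subseteq> cyl n" using prescribed_subset by auto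
  obtain r where r: "retraction (cyl n) ?B r"
    using affine_simplex_retract[OF T1 Tc] unfolding retract_of_def by blast
  define F where "F j = {p \<in> ?B. fst p j = 0}" for j
  define \<phi> where "\<phi> j p = h m (Act X m n (coface m j) x) (cpush n (codegeneracy m j) p)" for j p
  let ?I = "insert None (Some ` {..n})"
  have face: "Act X m n (coface m j) x \<in> Simp X m" for j
    using simplicial_set_Act[OF X coface_Delta, of x m j] x Suc by simp
  have \<phi>g: "\<phi> j p = g n x p" if "j \<le> n" "p \<in> F j" "p \<in> prescribed n T" for j p
  proof -
    have pr: "cpush n (codegeneracy m j) p \<in> prescribed m T"
      using that Suc by (intro cpush_prescribed) (auto intro: codegeneracy_Delta)
    have "\<phi> j p = g m (Act X m n (coface m j) x) (cpush n (codegeneracy m j) p)"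
      unfolding \<phi>_def using h face pr Suc by (intro solution_ext) auto
    also have "\<dots> = g n x (cpush m (coface m j) (cpush n (codegeneracy m j) p))"
      using g_nat[OF coface_Delta _ pr] x Suc by simp
    also have "cpush m (coface m j) (cpush n (codegeneracy m j) p) = p"
      using cpush_coface_codegeneracy[of p m T j] that Suc prescribed_subset by (auto simp: F_def)
    finally show ?thesis .
  qed
  have \<phi>\<phi>: "\<phi> i p = \<phi> j p" if "i \<le> n" "j \<le> n" "p \<in> F i" "p \<in> F j" for i j p
  proof -
    have *: "\<phi> i p = \<phi> j p" if "i < j" "j \<le> n" "p \<in> F i" "p \<in> F j" for i j
      using boundary_compatible[of m h x p i j] h x that Suc BE by (auto simp: \<phi>_def F_def)
    show ?thesis using that by (cases i j rule: linorder_cases) (auto simp: *)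
  qed
  obtain b where b: "continuous_map (top_of_set ?B) A b"
    and b_eq: "\<And>p i. i \<in> ?I \<Longrightarrow> p \<in> topspace (top_of_set ?B) \<inter> case_option (prescribed n T) F i \<Longrightarrow>
      b p = case_option (g n x) \<phi> i p"
  proof (rule pasting_lemma_exists_closed[of ?I "top_of_set ?B" "case_option (prescribed n T) F" A
        "case_option (g n x) \<phi>"])
    show "topspace (top_of_set ?B) \<subseteq> \<Union> (case_option (prescribed n T) F ` ?I)"
      by (auto simp: F_def)
    show "closedin (top_of_set ?B) (case_option (prescribed n T) F i)" if "i \<in> ?I" for i
    proof (cases i)
      case None
      have cl: "closed ({p::(nat \<Rightarrow> real) \<times> real. \<forall>i. 0 \<le> fst p i} \<union> {p. \<bar>snd p\<bar> = 1})"
        by (intro closed_Un closed_Collect_all closed_Collect_le closed_Collect_eq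
            continuous_intros continuous_on_fst_nth)
      have eq: "prescribed n T =
          ?B \<inter> ({p. \<forall>i. 0 \<le> fst p i} \<union> {p. \<bar>snd p\<bar> = 1})"
        by (auto simp: prescribed_def standard_simplex_eq)
      have "closedin (top_of_set ?B) (prescribed n T)"
        using closedin_closed_Int[OF cl, of ?B] unfolding eq[symmetric] .
      then show ?thesis using None by simp
    next
      case (Some j)
      have cl: "closed {p::(nat \<Rightarrow> real) \<times> real. fst p j = 0}"
        by (intro closed_Collect_eq continuous_intros continuous_on_fst_nth)
      have eq: "F j = ?B \<inter> {p. fst p j = 0}" by (auto simp: F_def)
      have "closedin (top_of_set ?B) (F j)"
        using closedin_closed_Int[OF cl, of ?B] unfolding eq[symmetric] .
      then show ?thesis using Some by simp
    qed
    show "continuous_map (subtopology (top_of_set ?B) (case_option (prescribed n T) F i)) A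
        (case_option (g n x) \<phi> i)" if "i \<in> ?I" for i
    proof (cases i)
      case None
      have "?B \<inter> prescribed n T = prescribed n T" by auto
      then show ?thesis using None g_cont[OF x] by (simp add: subtopology_subtopology)
    next
      case (Some j)
      have "continuous_map (top_of_set (?B \<inter> F j)) A (\<phi> j)"
        unfolding \<phi>_def
      proof (rule continuous_map_cpush)
        show "codegeneracy m j \<in> Delta n m" using that Some Suc by (auto intro: codegeneracy_Delta)
        show "?B \<inter> F j \<subseteq> cyl n" using BE by auto
        show "continuous_map (top_of_set (cyl m)) A (h m (Act X m n (coface m j) x))"
          using h face Suc by (intro solution_cont) auto
      qed
      then show ?thesis using Some by (simp add: subtopology_subtopology)
    qed
    show "case_option (g n x) \<phi> i p = case_option (g n x) \<phi> j p"
      if "i \<in> ?I" "j \<in> ?I" "p \<in> topspace (top_of_set ?B) \<inter> case_option (prescribed n T) F i \<inter>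
        case_option (prescribed n T) F j" for i j p
    proof -
      have "p \<in> case_option (prescribed n T) F i" "p \<in> case_option (prescribed n T) F j"
        using that(3) by blast+
      then show ?thesis
        using that(1,2) by (cases i; cases j) (auto intro: \<phi>g \<phi>g[symmetric] \<phi>\<phi>)
    qed
  qed auto
  have "continuous_map (top_of_set (cyl n)) (top_of_set ?B) r"
    using r unfolding retraction_def by auto
  then have br: "continuous_map (top_of_set (cyl n)) A (b \<circ> r)"
    using b by (rule continuous_map_compose)
  have rB: "r p = p" if "p \<in> ?B" for p
    using r that unfolding retraction_def by blast
  have br_ext: "(b \<circ> r) p = g n x p" if "p \<in> prescribed n T" for p
    using rB[of p] b_eq[of None p] that by auto
  have br_face: "(b \<circ> r) (cpush m (coface m j) p) = h m (Act X m n (coface m j) x) p"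
    if j: "j \<le> n" and p: "p \<in> cyl m" for j p
  proof -
    let ?q = "cpush m (coface m j) p"
    have q: "?q \<in> cyl n" using cpush_affine[OF coface_Delta p] Suc by simp
    have "{i. i \<le> m \<and> coface m j i = j} = {}" by (auto simp: coface_def)
    then have "fst ?q j = 0" unfolding cpush_def push_def by (simp only: fst_conv sum.empty)
    then have qB: "?q \<in> ?B" "?q \<in> F j" using q j by (auto simp: F_def case_prod_beta)
    then have "(b \<circ> r) ?q = \<phi> j ?q" using rB[of ?q] b_eq[of "Some j" ?q] j by simp
    also have "\<dots> = h m (Act X m n (coface m j) x) p"
      using cpush_compose[OF coface_Delta[of m j], of "codegeneracy m j" p] j Suc cpush_id[OF p]
      by (simp add: \<phi>_def codegeneracy_coface)
    finally show ?thesis .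
  qed
  show ?thesis
  proof (rule that[OF br br_ext])
    show "(b \<circ> r) (cpush m' (coface m' j) p) = h m' (Act X m' n (coface m' j) x) p"
      if "n = Suc m'" "j \<le> n" "p \<in> cyl m'" for m' j p
      using br_face[of j p] that Suc by simp
  qed
qed

text \<open>
  The inductive step. The value on a degenerate \<open>n\<close>-simplex is forced by its minimal
  representation, and nondegenerate ones are filled. Naturality has to be checked for structure
  maps from \<open>X\<^sub>l\<close> with \<open>l < n\<close> to \<open>X\<^sub>n\<close> (\<open>e_nat\<close>) and for those from \<open>X\<^sub>n\<close> (\<open>h'_top\<close>); maps
  of ordinals that are not surjective are factored through a coface.
\<close>

lemma solution_step:
  assumes h: "solution_below n h"
  shows "\<exists>h'. solution_below (Suc n) h' \<and> (\<forall>k<n. h' k = h k)"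
proof -
  let ?d = "essential_dim X n"
  define Q where "Q x k \<longleftrightarrow>
      continuous_map (top_of_set (cyl n)) A k \<and> (\<forall>p\<in>prescribed n T. k p = g n x p) \<and>
      (?d x < n \<longrightarrow> (\<exists>f\<in>Delta n (?d x). \<exists>z\<in>Simp X (?d x). x = Act X n (?d x) f z \<and>
          (\<forall>p. k p = h (?d x) z (cpush n f p)))) \<and>
      (?d x = n \<longrightarrow> (\<forall>m j. \<forall>p\<in>cyl m. n = Suc m \<longrightarrow> j \<le> n \<longrightarrow>
        k (cpush m (coface m j) p) = h m (Act X m n (coface m j) x) p))" for x k
  have "\<exists>k. Q x k" if x: "x \<in> Simp X n" for x
  proof (cases "?d x < n")
    case True
    obtain f z where fz: "f \<in> Delta n (?d x)" "z \<in> Simp X (?d x)" "x = Act X n (?d x) f z"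
      using essential_rep[OF X x] by blast
    let ?k = "\<lambda>p. h (?d x) z (cpush n f p)"
    have "continuous_map (top_of_set (cyl n)) A ?k"
      by (rule continuous_map_cpush[OF fz(1) subset_refl solution_cont[OF h True fz(2)]])
    moreover have "?k p = g n x p" if "p \<in> prescribed n T" for p
    proof -
      have "?k p = g (?d x) z (cpush n f p)"
        by (rule solution_ext[OF h True fz(2) cpush_prescribed[OF fz(1) that]])
      also have "\<dots> = g n (Act X n (?d x) f z) p"
        by (rule g_nat[OF fz(1,2) that, symmetric])
      finally show ?thesis using fz(3) by simp
    qed
    moreover have "\<exists>f\<in>Delta n (?d x). \<exists>z\<in>Simp X (?d x). x = Act X n (?d x) f z \<and>
          (\<forall>p. ?k p = h (?d x) z (cpush n f p))"
      by (intro bexI[OF _ fz(1)] bexI[OF _ fz(2)] conjI[OF fz(3)] allI refl)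
    ultimately have "Q x ?k"
      unfolding Q_def using True by (metis (no_types, lifting) less_irrefl)
    then show ?thesis by blast
  next
    case False
    obtain k where "continuous_map (top_of_set (cyl n)) A k"
      "\<And>p. p \<in> prescribed n T \<Longrightarrow> k p = g n x p"
      "\<And>m j p. n = Suc m \<Longrightarrow> j \<le> n \<Longrightarrow> p \<in> cyl m \<Longrightarrow>
        k (cpush m (coface m j) p) = h m (Act X m n (coface m j) x) p"
      using fill[OF h x] by blast
    then have "Q x k" unfolding Q_def using False by blast
    then show ?thesis by blast
  qed
  then obtain e where e: "\<And>x. x \<in> Simp X n \<Longrightarrow> Q x (e x)" by metis
  \<comment> \<open>e x was chosen through one minimal representation; by uniqueness any representation serves\<close>
  have e_nat: "e (Act X n l f z) p = h l z (cpush n f p)"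
    if "f \<in> Delta n l" "l < n" "z \<in> Simp X l" "p \<in> cyl n" for l f z p
    using that
  proof (induction l arbitrary: f z rule: less_induct)
    case (less l)
    define x where "x = Act X n l f z"
    have x: "x \<in> Simp X n" unfolding x_def by (rule simplicial_set_Act[OF X less.prems(1,3)])
    define d where "d = ?d x"
    have "d \<le> l" unfolding d_def by (rule essential_dim_le[OF less.prems(1,3) x_def])
    then have dn: "d < n" using less.prems by simp
    then obtain w v where w: "w \<in> Delta n d" "v \<in> Simp X d" "x = Act X n d w v"
      and ex: "\<And>p. e x p = h d v (cpush n w p)"
      using e[OF x] unfolding Q_def d_def by blast
    show ?case
    proof (cases "f ` {..n} = {..l}")
      case True
      obtain s where s: "s \<in> Delta l n" "\<And>j. j \<le> l \<Longrightarrow> f (s j) = j"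
        using Delta_section[OF less.prems(1) True, of 0] by auto
      let ?ws = "compose {..l} w s"
      have ws: "?ws \<in> Delta l d" by (rule Delta_compose[OF s(1) w(1)])
      have "compose {..l} f s = (\<lambda>i\<in>{..l}. i)" using s(2) by (auto simp: compose_def)
      then have "z = Act X l l (compose {..l} f s) z"
        using simplicial_set_Act_id[OF X less.prems(3)] by simp
      also have "\<dots> = Act X l n s x"
        using simplicial_set_Act_compose[OF X s(1) less.prems(1,3)] x_def by simp
      also have "\<dots> = Act X l d ?ws v"
        using simplicial_set_Act_compose[OF X s(1) w(1,2)] w(3) by simp
      finally have z: "z = Act X l d ?ws v" .
      have wsf: "compose {..n} ?ws f \<in> Delta n d" by (rule Delta_compose[OF less.prems(1) ws])
      have "x = Act X n d (compose {..n} ?ws f) v"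
        using simplicial_set_Act_compose[OF X less.prems(1) ws w(2)] z x_def by simp
      then have "compose {..n} ?ws f = w"
        by (rule essential_rep_unique(1)[OF X d_def w wsf w(2)])
      then have "e x p = h d v (cpush l ?ws (cpush n f p))"
        using ex cpush_compose[OF less.prems(1)] by metis
      also have "\<dots> = h l (Act X l d ?ws v) (cpush n f p)"
        using h less.prems(2) dn ws w(2) cpush_affine[OF less.prems(1,4)]
        by (intro solution_nat[symmetric])
      finally show ?thesis using z x_def by simp
    next
      case False
      then obtain j where j: "j \<le> l" "j \<notin> f ` {..n}"
        using Delta_le[OF less.prems(1)] by auto
      have "l \<noteq> 0" using j Delta_le[OF less.prems(1), of 0] by force
      then obtain k where k: "l = Suc k" by (cases l) auto
      let ?f = "compose {..n} (codegeneracy k j) f"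
      have f': "?f \<in> Delta n k"
        using less.prems(1) j k by (intro Delta_compose[OF _ codegeneracy_Delta]) auto
      have eq: "compose {..n} (coface k j) ?f = f"
        using less.prems(1) j k by (intro Delta_factor) auto
      have z': "Act X k l (coface k j) z \<in> Simp X k"
        using simplicial_set_Act[OF X coface_Delta] less.prems(3) k by simp
      have "Act X n l f z = Act X n k ?f (Act X k l (coface k j) z)"
        using simplicial_set_Act_compose[OF X f' coface_Delta, of z j] less.prems(3) k eq by simp
      then have "e (Act X n l f z) p = h k (Act X k l (coface k j) z) (cpush n ?f p)"
        using less.IH[OF _ f' _ z' less.prems(4)] k less.prems(2) by simp
      also have "\<dots> = h l z (cpush k (coface k j) (cpush n ?f p))"
        using h less.prems k cpush_affine[OF f' less.prems(4)]
        by (intro solution_nat) (auto intro: coface_Delta)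
      also have "\<dots> = h l z (cpush n f p)"
        using cpush_compose[OF f', of "coface k j" p] eq by simp
      finally show ?thesis .
    qed
  qed
  define h' where "h' = h(n := e)"
  have h'_lower: "h' i (Act X i l f z) p = h l z (cpush i f p)"
    if "f \<in> Delta i l" "i \<le> n" "l < n" "z \<in> Simp X l" "p \<in> cyl i" for i l f z p
    using that e_nat solution_nat[OF h, of i l f z p] by (cases "i = n") (auto simp: h'_def)
  have h'_top: "h' i (Act X i n f x) p = e x (cpush i f p)"
    if f: "f \<in> Delta i n" and i: "i \<le> n" and x: "x \<in> Simp X n" and p: "p \<in> cyl i" for i f x p
  proof (cases "?d x < n")
    case True
    then obtain w v where w: "w \<in> Delta n (?d x)" "v \<in> Simp X (?d x)" "x = Act X n (?d x) w v"
      and ex: "\<And>p. e x p = h (?d x) v (cpush n w p)"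
      using e[OF x] unfolding Q_def by blast
    have "Act X i n f x = Act X i (?d x) (compose {..i} w f) v"
      using simplicial_set_Act_compose[OF X f w(1,2)] w(3) by simp
    then have "h' i (Act X i n f x) p = h (?d x) v (cpush i (compose {..i} w f) p)"
      using h'_lower[OF Delta_compose[OF f w(1)] i True w(2) p] by simp
    then show ?thesis using ex cpush_compose[OF f] by simp
  next
    case False
    then have d: "?d x = n" using essential_dim_le_self[OF X x] by simp
    show ?thesis
    proof (cases "f ` {..i} = {..n}")
      case True
      then have "card {..n} \<le> card {..i}" using card_image_le[of "{..i}" f] by simp
      then have "i = n" using i by simp
      moreover from this have "f = (\<lambda>i\<in>{..n}. i)" using Delta_surj_self[of f n] f True by simp
      ultimately show ?thesis
        using simplicial_set_Act_id[OF X x] cpush_id[of p n T] p by (simp add: h'_def)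
    next
      case False
      then obtain j where j: "j \<le> n" "j \<notin> f ` {..i}" using Delta_le[OF f] by auto
      have "n \<noteq> 0" using j Delta_le[OF f, of 0] by force
      then obtain k where k: "n = Suc k" by (cases n) auto
      let ?f = "compose {..i} (codegeneracy k j) f"
      have f': "?f \<in> Delta i k"
        using f j k by (intro Delta_compose[OF _ codegeneracy_Delta]) auto
      have eq: "compose {..i} (coface k j) ?f = f"
        using f j k by (intro Delta_factor) auto
      have z': "Act X k n (coface k j) x \<in> Simp X k"
        using simplicial_set_Act[OF X coface_Delta] x k by simp
      have "Act X i n f x = Act X i k ?f (Act X k n (coface k j) x)"
        using simplicial_set_Act_compose[OF X f' coface_Delta, of x j] x k eq by simp
      then have "h' i (Act X i n f x) p = h k (Act X k n (coface k j) x) (cpush i ?f p)"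
        using h'_lower[OF f' i _ z' p] k by simp
      also have "\<dots> = e x (cpush k (coface k j) (cpush i ?f p))"
        using e[OF x] d k j(1) cpush_affine[OF f' p] unfolding Q_def by metis
      also have "\<dots> = e x (cpush i f p)"
        using cpush_compose[OF f', of "coface k j" p] eq by simp
      finally show ?thesis .
    qed
  qed
  have "solution_below (Suc n) h'"
    unfolding solution_below_def
  proof (intro conjI allI impI ballI)
    fix i x assume i: "i < Suc n" and x: "x \<in> Simp X i"
    show "continuous_map (top_of_set (cyl i)) A (h' i x)"
      using e[of x] solution_cont[OF h, of i x] x i by (cases "i = n") (auto simp: h'_def Q_def)
    show "h' i x p = g i x p" if "p \<in> prescribed i T" for p
      using e[of x] solution_ext[OF h, of i x p] x i that by (cases "i = n") (auto simp: h'_def Q_def)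
  next
    fix i l f x p assume "i < Suc n" "l < Suc n" "f \<in> Delta i l" "x \<in> Simp X l" "p \<in> cyl i"
    then show "h' i (Act X i l f x) p = h' l x (cpush i f p)"
      using h'_lower[of f i l x p] h'_top[of f i x p] by (cases "l = n") (auto simp: h'_def)
  qed
  then show ?thesis by (intro exI[of _ h']) (simp add: h'_def)
qed

lemma extension_exists:
  obtains h where
    "\<And>n x. x \<in> Simp X n \<Longrightarrow> continuous_map (top_of_set (affine_simplex n \<times> T)) A (h n x)"
    "\<And>n x p. x \<in> Simp X n \<Longrightarrow> p \<in> prescribed n T \<Longrightarrow> h n x p = g n x p"
    "\<And>n m f x p. f \<in> Delta n m \<Longrightarrow> x \<in> Simp X m \<Longrightarrow> p \<in> affine_simplex n \<times> T \<Longrightarrow>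
        h n (Act X n m f x) p = h m x (cpush n f p)"
proof -
  have "\<exists>h. solution_below 0 h" by (simp add: solution_below_def)
  then obtain F where F: "\<And>n. solution_below n (F n)" "\<And>n k. k < n \<Longrightarrow> F (Suc n) k = F n k"
    using dependent_nat_choice[of solution_below "\<lambda>n h h'. \<forall>k<n. h' k = h k"] solution_step by metis
  have eq: "F N k = F (Suc k) k" if "k < N" for N k
    using that by (induction N) (auto simp: F(2) less_Suc_eq)
  show ?thesis
  proof (rule that[of "\<lambda>n. F (Suc n) n"])
    show "F (Suc n) n (Act X n m f x) p = F (Suc m) m x (cpush n f p)"
      if "f \<in> Delta n m" "x \<in> Simp X m" "p \<in> cyl n" for n m f x p
      using solution_nat[OF F(1)[of "Suc (max n m)"], of n m f x p] that
        eq[of n "Suc (max n m)"] eq[of m "Suc (max n m)"] by simp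
  qed (use solution_cont[OF F(1)] solution_ext[OF F(1)] in auto)
qed
end

section \<open>Continuous maps and homotopies on realizations\<close>

lemma realization_class_eqI:
  "(p, q) \<in> realization_rel X \<Longrightarrow> realization_rel X `` {p} = realization_rel X `` {q}"
proof -
  have "sym (glue X \<union> (glue X)\<inverse>)" by (auto simp: sym_def)
  then have sym: "sym (realization_rel X)" unfolding realization_rel_def by (rule sym_rtrancl)
  have trans: "trans (realization_rel X)" unfolding realization_rel_def by (rule trans_rtrancl)
  assume "(p, q) \<in> realization_rel X"
  then have "(p, z) \<in> realization_rel X \<longleftrightarrow> (q, z) \<in> realization_rel X" for z
    using sym trans by (meson symD transD)
  then show ?thesis by blast
qed

lemma realization_class_Act:
  assumes "f \<in> Delta n m" "x \<in> Simp X m" "t \<in> standard_simplex n"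
  shows "realization_rel X `` {(n, Act X n m f x, t)} = realization_rel X `` {(m, x, push n f t)}"
  using assms by (intro realization_class_eqI) (auto simp: realization_rel_def glue_def)

lemma realization_class_refl: "p \<in> realization_rel X `` {p}"
  by (simp add: realization_rel_def)

lemma topspace_simplex_sum:
  "topspace (simplex_sum X) = {(n, x, t). x \<in> Simp X n \<and> t \<in> standard_simplex n}"
  by (auto simp: simplex_sum_def)

lemma quotient_map_realization:
  "quotient_map (simplex_sum X) (realization X) (\<lambda>p. realization_rel X `` {p})"
  unfolding realization_def by (rule quotient_map_quotient_topology)

lemma topspace_realization:
  "topspace (realization X) = {realization_rel X `` {(n, x, t)} | n x t. x \<in> Simp X n \<and> t \<in> standard_simplex n}"
  by (auto simp: realization_def topspace_simplex_sum)

text \<open>A function that respects the generating identifications is constant on equivalence classes.\<close>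

lemma realization_rel_respects:
  assumes glue: "\<And>n m f x t. f \<in> Delta n m \<Longrightarrow> x \<in> Simp X m \<Longrightarrow> t \<in> standard_simplex n \<Longrightarrow>
      F (n, Act X n m f x, t) = F (m, x, push n f t)"
    and "(p, q) \<in> realization_rel X"
  shows "F p = F q"
proof -
  have "F p = F q" if "(p, q) \<in> glue X" for p q
    using that glue unfolding glue_def by blast
  then have gen: "F p = F q" if "(p, q) \<in> glue X \<union> (glue X)\<inverse>" for p q
    using that by (metis UnE converseD)
  show ?thesis
    using assms(2) unfolding realization_rel_def
  proof (induction rule: rtrancl_induct)
    case (step y z)
    then show ?case using gen[of y z] by simp
  qed simp
qed


text \<open>
  A product distributes over a disjoint union. By this lemma and the next one, continuity on the
  product of an interval with \<open>simplex_sum X\<close> can be tested on each single simplex.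
\<close>

lemma continuous_map_discrete_prod:
  assumes "\<And>x. x \<in> S \<Longrightarrow> continuous_map (prod_topology Z Y) W (\<lambda>(v, t). F v x t)"
  shows "continuous_map (prod_topology Z (prod_topology (discrete_topology S) Y)) W (\<lambda>(v, x, t). F v x t)"
proof (rule pasting_lemma[where I = S and T = "\<lambda>x. topspace Z \<times> {x} \<times> topspace Y" and f = "\<lambda>x (v, _, t). F v x t"])
  let ?P = "prod_topology Z (prod_topology (discrete_topology S) Y)"
  fix x assume x: "x \<in> S"
  show "openin ?P (topspace Z \<times> {x} \<times> topspace Y)"
    using x by (simp add: openin_prod_Times_iff)
  have "continuous_map ?P (prod_topology Z Y) (\<lambda>p. (fst p, snd (snd p)))"
    by (intro continuous_map_pairedI continuous_map_fst
        continuous_map_compose[OF continuous_map_snd continuous_map_snd, unfolded o_def])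
  then have "continuous_map ?P W ((\<lambda>(v, t). F v x t) \<circ> (\<lambda>p. (fst p, snd (snd p))))"
    using assms[OF x] by (rule continuous_map_compose)
  then have "continuous_map ?P W (\<lambda>(v, _, t). F v x t)"
    by (rule continuous_map_eq) auto
  then show "continuous_map (subtopology ?P (topspace Z \<times> {x} \<times> topspace Y)) W (\<lambda>(v, _, t). F v x t)"
    by (rule continuous_map_from_subtopology)
qed auto

lemma continuous_map_sum_prod:
  assumes "\<And>n. n \<in> I \<Longrightarrow> continuous_map (prod_topology Z (Y n)) W (\<lambda>(v, y). F v n y)"
  shows "continuous_map (prod_topology Z (sum_topology Y I)) W (\<lambda>(v, n, y). F v n y)"
proof -
  let ?P = "prod_topology Z (sum_topology Y I)"
  let ?F = "\<lambda>(v, n, y). F v n y"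
  show ?thesis
    unfolding continuous_map_def
  proof (intro conjI allI impI)
    show "?F \<in> topspace ?P \<rightarrow> topspace W"
    proof
      fix p assume "p \<in> topspace ?P"
      then obtain v n y where "p = (v, n, y)" "n \<in> I" "(v, y) \<in> topspace (prod_topology Z (Y n))"
        by auto
      then show "?F p \<in> topspace W" using funcset_mem[OF continuous_map_funspace[OF assms]] by force
    qed
    fix U assume U: "openin W U"
    show "openin ?P {p \<in> topspace ?P. ?F p \<in> U}"
    proof (subst openin_subopen, intro ballI)
      fix p assume p: "p \<in> {p \<in> topspace ?P. ?F p \<in> U}"
      then obtain v n y where vny: "p = (v, n, y)" "v \<in> topspace Z" "n \<in> I" "y \<in> topspace (Y n)" "F v n y \<in> U"
        by auto
      have op: "openin (prod_topology Z (Y n)) {q \<in> topspace (prod_topology Z (Y n)). (\<lambda>(v, y). F v n y) q \<in> U}"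
        using assms[OF vny(3)] U by (rule openin_continuous_map_preimage)
      have mem: "(v, y) \<in> {q \<in> topspace (prod_topology Z (Y n)). (\<lambda>(v, y). F v n y) q \<in> U}"
        using vny by simp
      obtain G H where GH: "openin Z G" "openin (Y n) H" "v \<in> G" "y \<in> H"
        "G \<times> H \<subseteq> {q \<in> topspace (prod_topology Z (Y n)). (\<lambda>(v, y). F v n y) q \<in> U}"
        using iffD1[OF openin_prod_topology_alt op, rule_format, OF mem] by (elim exE conjE) (rule that)
      have "openin (sum_topology Y I) (Pair n ` H)"
        using open_map_component_injection[OF vny(3), of Y] GH(2) by (simp add: open_map_def)
      then have "openin ?P (G \<times> Pair n ` H)"
        using GH(1) by (simp add: openin_prod_Times_iff)
      moreover have "p \<in> G \<times> Pair n ` H" using vny GH by auto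
      moreover have "G \<times> Pair n ` H \<subseteq> {p \<in> topspace ?P. ?F p \<in> U}"
        using GH(5) vny(3) by (auto dest!: subsetD)
      ultimately show "\<exists>V. openin ?P V \<and> p \<in> V \<and> V \<subseteq> {p \<in> topspace ?P. ?F p \<in> U}" by blast
    qed
  qed
qed

text \<open>
  The product of a quotient map with the identity of a compact interval has the universal
  property of a quotient map. If \<open>Op\<close> is the preimage of an open set and \<open>N\<close> a compact
  neighbourhood of a point of the interval, then by compactness the points \<open>x\<close> with
  \<open>N \<times> {x} \<subseteq> Op\<close> form an open set \<open>V\<close>, and \<open>V\<close> is saturated.
\<close>

lemma continuous_map_prod_quotient:
  fixes F :: "real \<times> 'b \<Rightarrow> 'c"
  assumes q: "quotient_map X Y q"
    and F: "continuous_map (prod_topology (top_of_set {a..b}) X) Z (\<lambda>(v, x). F (v, q x))"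
  shows "continuous_map (prod_topology (top_of_set {a..b}) Y) Z F"
  unfolding continuous_map_def
proof (intro conjI allI impI)
  let ?P = "prod_topology (top_of_set {a..b}) X"
  let ?Q = "prod_topology (top_of_set {a..b}) Y"
  have surj: "q ` topspace X = topspace Y" by (rule quotient_imp_surjective_map[OF q])
  show "F \<in> topspace ?Q \<rightarrow> topspace Z"
  proof
    fix p assume "p \<in> topspace ?Q"
    then obtain v y where "p = (v, y)" "v \<in> {a..b}" "y \<in> q ` topspace X"
      using surj by auto
    then obtain x where "p = (v, q x)" "v \<in> {a..b}" "x \<in> topspace X"
      by blast
    then show "F p \<in> topspace Z" using continuous_map_funspace[OF F] by (fastforce simp: Pi_iff)
  qed
  fix W assume W: "openin Z W"
  define Op where "Op = {p \<in> topspace ?P. F (fst p, q (snd p)) \<in> W}"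
  have Op: "openin ?P Op"
    using openin_continuous_map_preimage[OF F W] by (simp add: Op_def case_prod_beta)
  show "openin ?Q {p \<in> topspace ?Q. F p \<in> W}"
  proof (subst openin_subopen, intro ballI)
    fix p assume "p \<in> {p \<in> topspace ?Q. F p \<in> W}"
    then obtain v y where "p = (v, y)" "v \<in> {a..b}" "y \<in> q ` topspace X" "F p \<in> W"
      using surj by auto
    then obtain x where p: "p = (v, q x)" "v \<in> {a..b}" "x \<in> topspace X" "F (v, q x) \<in> W"
      by blast
    then have mem: "(v, x) \<in> Op" by (simp add: Op_def)
    obtain G H where GH: "openin (top_of_set {a..b}) G" "openin X H" "v \<in> G" "x \<in> H" "G \<times> H \<subseteq> Op"
      using iffD1[OF openin_prod_topology_alt Op, rule_format, OF mem] by (elim exE conjE) (rule that)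
    then obtain e where e: "e > 0" "cball v e \<inter> {a..b} \<subseteq> G"
      unfolding openin_contains_cball by blast
    define N where "N = cball v e \<inter> {a..b}"
    have N: "compact N" unfolding N_def by (intro compact_Int_closed) auto
    define V where "V = {x' \<in> topspace X. \<forall>v'\<in>N. (v', x') \<in> Op}"
    have "closed_map (prod_topology (top_of_set N) X) X snd"
      using N by (intro closed_map_snd) (simp add: compact_space_subtopology)
    moreover have "closedin (prod_topology (top_of_set N) X) ((N \<times> topspace X) - Op)"
    proof -
      have NX: "{a..b} \<times> topspace X \<inter> N \<times> topspace X = N \<times> topspace X"
        by (auto simp: N_def)
      have "prod_topology (top_of_set N) X = subtopology ?P (N \<times> topspace X)"
        using NX by (simp add: prod_topology_subtopology subtopology_subtopology)
      then have "openin (prod_topology (top_of_set N) X) ((N \<times> topspace X) \<inter> Op)"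
        using Op by (simp add: openin_subtopology_Int2)
      then have "closedin (prod_topology (top_of_set N) X) (topspace (prod_topology (top_of_set N) X) - (N \<times> topspace X) \<inter> Op)"
        by blast
      moreover have "topspace (prod_topology (top_of_set N) X) - (N \<times> topspace X) \<inter> Op = (N \<times> topspace X) - Op"
        by auto
      ultimately show ?thesis by simp
    qed
    ultimately have "closedin X (snd ` ((N \<times> topspace X) - Op))"
      unfolding closed_map_def by blast
    then have "openin X (topspace X - snd ` ((N \<times> topspace X) - Op))" by blast
    moreover have "topspace X - snd ` ((N \<times> topspace X) - Op) = V"
      by (force simp: V_def)
    ultimately have V: "openin X V" by simp
    have sat: "{x' \<in> topspace X. q x' \<in> q ` V} = V"
      by (auto simp: V_def Op_def)
    have "q ` V \<subseteq> topspace Y" using surj by (auto simp: V_def)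
    moreover have "openin X {x' \<in> topspace X. q x' \<in> q ` V}"
      using V by (simp only: sat)
    ultimately have qV: "openin Y (q ` V)"
      using q unfolding quotient_map_def by blast
    define M where "M = ball v e \<inter> {a..b}"
    have "openin (top_of_set {a..b}) M"
      unfolding M_def by (metis Int_commute openin_open_Int open_ball)
    then have "openin ?Q (M \<times> q ` V)" using qV by (simp add: openin_prod_Times_iff)
    moreover have "x \<in> V" using p GH e by (auto simp: V_def N_def)
    then have "p \<in> M \<times> q ` V" using p e by (auto simp: M_def)
    moreover have "M \<times> q ` V \<subseteq> {p \<in> topspace ?Q. F p \<in> W}"
    proof
      fix z assume "z \<in> M \<times> q ` V"
      then obtain v' x' where z: "z = (v', q x')" "v' \<in> M" "x' \<in> V" by auto
      then have "v' \<in> N" by (auto simp: M_def N_def)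
      then have "(v', x') \<in> Op" using z by (simp add: V_def)
      then show "z \<in> {p \<in> topspace ?Q. F p \<in> W}" using z surj by (auto simp: Op_def)
    qed
    ultimately show "\<exists>T. openin ?Q T \<and> p \<in> T \<and> T \<subseteq> {p \<in> topspace ?Q. F p \<in> W}" by blast
  qed
qed

text \<open>
  A family of homotopies of simplices that is compatible with the structure maps descends to
  the realization.
\<close>

lemma continuous_map_realization_homotopy:
  fixes G :: "real \<Rightarrow> nat \<Rightarrow> 'x \<Rightarrow> (nat \<Rightarrow> real) \<Rightarrow> 'b"
  assumes cont: "\<And>n x. x \<in> Simp X n \<Longrightarrow>
      continuous_map (prod_topology (top_of_set {a..b}) (top_of_set (standard_simplex n))) Z (\<lambda>(v, t). G v n x t)"
    and glue: "\<And>v n m f x t. f \<in> Delta n m \<Longrightarrow> x \<in> Simp X m \<Longrightarrow> t \<in> standard_simplex n \<Longrightarrow>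
      v \<in> {a..b} \<Longrightarrow> G v n (Act X n m f x) t = G v m x (push n f t)"
  obtains K where "continuous_map (prod_topology (top_of_set {a..b}) (realization X)) Z K"
    "\<And>v n x t. x \<in> Simp X n \<Longrightarrow> t \<in> standard_simplex n \<Longrightarrow> v \<in> {a..b} \<Longrightarrow>
        K (v, realization_rel X `` {(n, x, t)}) = G v n x t"
proof -
  \<comment> \<open>evaluation at an arbitrary representative of the class\<close>
  define K where "K = (\<lambda>(v, C). case (SOME p. p \<in> C) of (n, x, t) \<Rightarrow> G v n x t)"
  have K: "K (v, realization_rel X `` {(n, x, t)}) = G v n x t" if "v \<in> {a..b}" for v n x t
  proof -
    let ?C = "realization_rel X `` {(n, x, t)}"
    define p where "p = (SOME p. p \<in> ?C)"
    have "p \<in> ?C" unfolding p_def using realization_class_refl by (rule someI)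
    then have rel: "((n, x, t), p) \<in> realization_rel X" by simp
    have "(case (n, x, t) of (n, x, t) \<Rightarrow> G v n x t) = (case p of (n, x, t) \<Rightarrow> G v n x t)"
    proof (rule realization_rel_respects[OF _ rel])
      show "(case (n, Act X n m f x, t) of (n, x, t) \<Rightarrow> G v n x t) =
          (case (m, x, push n f t) of (n, x, t) \<Rightarrow> G v n x t)"
        if "f \<in> Delta n m" "x \<in> Simp X m" "t \<in> standard_simplex n" for n m f x t
        using glue[OF that \<open>v \<in> {a..b}\<close>] by simp
    qed
    then show ?thesis by (simp add: K_def p_def)
  qed
  have "continuous_map (prod_topology (top_of_set {a..b}) (simplex_sum X)) Z (\<lambda>(v, n, x, t). G v n x t)"
    unfolding simplex_sum_def powertop_real_euclidean
    by (intro continuous_map_sum_prod continuous_map_discrete_prod cont)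
  then have "continuous_map (prod_topology (top_of_set {a..b}) (simplex_sum X)) Z
      (\<lambda>(v, p). K (v, realization_rel X `` {p}))"
    by (rule continuous_map_eq) (auto simp: K)
  then have "continuous_map (prod_topology (top_of_set {a..b}) (realization X)) Z K"
    by (rule continuous_map_prod_quotient[OF quotient_map_realization])
  then show ?thesis using K that by blast
qed

lemma continuous_map_simplex_class:
  assumes x: "x \<in> Simp X n" and c: "continuous_map Z (top_of_set (standard_simplex n)) c"
  shows "continuous_map Z (realization X) (\<lambda>z. realization_rel X `` {(n, x, c z)})"
proof -
  have "continuous_map Z (prod_topology (discrete_topology (Simp X n)) (top_of_set (standard_simplex n))) (\<lambda>z. (x, c z))"
    using x c by (intro continuous_map_pairedI) auto
  then have "continuous_map Z (simplex_sum X) (Pair n \<circ> (\<lambda>z. (x, c z)))"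
    unfolding simplex_sum_def powertop_real_euclidean
    by (rule continuous_map_compose) (rule continuous_map_component_injection[of n UNIV, simplified])
  then have "continuous_map Z (realization X) ((\<lambda>p. realization_rel X `` {p}) \<circ> (Pair n \<circ> (\<lambda>z. (x, c z))))"
    by (rule continuous_map_compose) (rule quotient_imp_continuous_map[OF quotient_map_realization])
  then show ?thesis by (simp add: o_def)
qed

lemma continuous_map_realization_map:
  assumes \<phi>: "simplicial_map X Y \<phi>"
  shows "continuous_map (realization X) (realization Y) (realization_map Y \<phi>)"
proof -
  \<comment> \<open>a constant homotopy, parametrized by the degenerate interval from 0 to 0\<close>
  define G where "G = (\<lambda>(v::real) n x t. realization_rel Y `` {(n, \<phi> n x, t)})"
  have \<phi>S: "\<phi> n x \<in> Simp Y n" if "x \<in> Simp X n" for n x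
    using \<phi> that unfolding simplicial_map_def by blast
  obtain K where K: "continuous_map (prod_topology (top_of_set {0..0::real}) (realization X)) (realization Y) K"
    and KG: "\<And>v n x t. x \<in> Simp X n \<Longrightarrow> t \<in> standard_simplex n \<Longrightarrow> v \<in> {0..0} \<Longrightarrow>
      K (v, realization_rel X `` {(n, x, t)}) = G v n x t"
  proof (rule continuous_map_realization_homotopy[of X 0 0 "realization Y" G])
    show "continuous_map (prod_topology (top_of_set {0..0}) (top_of_set (standard_simplex n))) (realization Y) (\<lambda>(v, t). G v n x t)"
      if "x \<in> Simp X n" for n x
      unfolding G_def case_prod_unfold
      by (rule continuous_map_simplex_class[OF \<phi>S[OF that] continuous_map_snd])
    show "G v n (Act X n m f x) t = G v m x (push n f t)"
      if "f \<in> Delta n m" "x \<in> Simp X m" "t \<in> standard_simplex n" for v n m f x t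
    proof -
      have "\<phi> n (Act X n m f x) = Act Y n m f (\<phi> m x)"
        using \<phi> that unfolding simplicial_map_def by blast
      then show ?thesis
        using realization_class_Act[OF that(1) \<phi>S[OF that(2)] that(3)] by (simp add: G_def)
    qed
  next
    fix K
    assume "continuous_map (prod_topology (top_of_set {0..0::real}) (realization X)) (realization Y) K"
      "\<And>v n x t. x \<in> Simp X n \<Longrightarrow> t \<in> standard_simplex n \<Longrightarrow> v \<in> {0..0} \<Longrightarrow>
        K (v, realization_rel X `` {(n, x, t)}) = G v n x t"
    then show thesis by (rule that)
  qed
  have "continuous_map (realization X) (prod_topology (top_of_set {0..0::real}) (realization X)) (\<lambda>C. (0, C))"
    by (intro continuous_map_pairedI) auto
  then have "continuous_map (realization X) (realization Y) (K \<circ> (\<lambda>C. (0, C)))"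
    using K by (rule continuous_map_compose)
  then show ?thesis
    by (rule continuous_map_eq) (auto simp: topspace_realization KG G_def realization_map_class[OF \<phi>])
qed

section \<open>A section of the restriction map and a fibrewise homotopy\<close>

text \<open>The comparison map: restriction of maps on the affine simplex to the standard simplex.\<close>

definition simplex_restriction :: "nat \<Rightarrow> ((nat \<Rightarrow> real) \<Rightarrow> 'a) \<Rightarrow> (nat \<Rightarrow> real) \<Rightarrow> 'a" where
  "simplex_restriction n \<sigma> = restrict \<sigma> (standard_simplex n)"

text \<open>The simplicial set $S$ of continuous maps from affine simplices to \<open>A\<close>.\<close>

abbreviation smooth_continuous_sset :: "'a topology \<Rightarrow> ((nat \<Rightarrow> real) \<Rightarrow> 'a) sset" where
  "smooth_continuous_sset A \<equiv> smooth_sset (continuous_diffeology A)"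

lemma simplicial_map_restriction:
  "simplicial_map (smooth_continuous_sset A) (singular_sset A) simplex_restriction"
  unfolding simplicial_map_def
proof (intro conjI allI ballI)
  fix n
  have "simplex_restriction n \<sigma> \<in> Simp (singular_sset A) n" if "\<sigma> \<in> Simp (smooth_continuous_sset A) n" for \<sigma>
  proof -
    have "continuous_map (top_of_set (standard_simplex n)) A \<sigma>"
      using that standard_subset_affine[of n]
      by (auto simp: Simp_smooth_sset_continuous intro: continuous_map_from_subtopology_mono)
    then have "continuous_map (top_of_set (standard_simplex n)) A (simplex_restriction n \<sigma>)"
      by (rule continuous_map_eq) (simp add: simplex_restriction_def)
    then show ?thesis by (simp add: Simp_singular_sset simplex_restriction_def)
  qed
  then show "simplex_restriction n \<in> Simp (smooth_continuous_sset A) n \<rightarrow> Simp (singular_sset A) n"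
    by blast
next
  fix n m f \<sigma> assume "f \<in> Delta n m"
  then show "simplex_restriction n (Act (smooth_continuous_sset A) n m f \<sigma>) =
      Act (singular_sset A) n m f (simplex_restriction m \<sigma>)"
    using standard_subset_affine[of n] push_standard_simplex[of f n m]
    by (auto simp: Act_smooth_sset Act_singular_sset simplex_restriction_def compose_def fun_eq_iff)
qed (rule simplicial_set_smooth_sset simplicial_set_singular_sset)+

lemma restriction_section:
  fixes A :: "'a topology"
  obtains s where "simplicial_map (singular_sset A) (smooth_continuous_sset A) s"
    "\<And>n \<sigma>. \<sigma> \<in> Simp (singular_sset A) n \<Longrightarrow> simplex_restriction n (s n \<sigma>) = \<sigma>"
proof -
  have pre: "prescribed n {0} = standard_simplex n \<times> {0}" for n
    using standard_subset_affine by (auto simp: prescribed_def)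
  interpret extension_problem "singular_sset A" A "{0}" "\<lambda>n \<sigma> p. \<sigma> (fst p)"
  proof
    show "simplicial_set (singular_sset A)" by (rule simplicial_set_singular_sset)
    show "continuous_map (top_of_set (prescribed n {0})) A (\<lambda>p. \<sigma> (fst p))"
      if "\<sigma> \<in> Simp (singular_sset A) n" for n \<sigma>
    proof -
      have "continuous_map (top_of_set (prescribed n {0})) (top_of_set (standard_simplex n)) fst"
        by (auto simp: pre intro: continuous_on_fst continuous_on_id)
      then have "continuous_map (top_of_set (prescribed n {0})) A (\<sigma> \<circ> fst)"
        by (rule continuous_map_compose) (use that in \<open>simp add: Simp_singular_sset\<close>)
      then show ?thesis by (simp add: o_def)
    qed
    show "Act (singular_sset A) n m f \<sigma> (fst p) = \<sigma> (fst (cpush n f p))"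
      if "p \<in> prescribed n {0}" for n m f \<sigma> p
      using that by (auto simp: pre Act_singular_sset compose_def cpush_def)
  qed auto
  obtain h where h: "\<And>n \<sigma>. \<sigma> \<in> Simp (singular_sset A) n \<Longrightarrow>
        continuous_map (top_of_set (affine_simplex n \<times> {0})) A (h n \<sigma>)"
      "\<And>n \<sigma> p. \<sigma> \<in> Simp (singular_sset A) n \<Longrightarrow> p \<in> prescribed n {0} \<Longrightarrow> h n \<sigma> p = \<sigma> (fst p)"
      "\<And>n m f \<sigma> p. f \<in> Delta n m \<Longrightarrow> \<sigma> \<in> Simp (singular_sset A) m \<Longrightarrow> p \<in> affine_simplex n \<times> {0} \<Longrightarrow>
        h n (Act (singular_sset A) n m f \<sigma>) p = h m \<sigma> (cpush n f p)"
    using extension_exists by blast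
  define s where "s n \<sigma> = restrict (\<lambda>y. h n \<sigma> (y, 0)) (affine_simplex n)" for n \<sigma>
  show ?thesis
  proof (rule that)
    show "simplicial_map (singular_sset A) (smooth_continuous_sset A) s"
      unfolding simplicial_map_def
    proof (intro conjI allI ballI)
      fix n
      have "s n \<sigma> \<in> Simp (smooth_continuous_sset A) n" if "\<sigma> \<in> Simp (singular_sset A) n" for \<sigma>
      proof -
        have "continuous_map (top_of_set (affine_simplex n)) (top_of_set (affine_simplex n \<times> {0::real})) (\<lambda>y. (y, 0))"
          by (auto intro!: continuous_intros)
        then have "continuous_map (top_of_set (affine_simplex n)) A (h n \<sigma> \<circ> (\<lambda>y. (y, 0)))"
          using h(1)[OF that] by (rule continuous_map_compose)
        then have "continuous_map (top_of_set (affine_simplex n)) A (s n \<sigma>)"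
          by (rule continuous_map_eq) (simp add: s_def)
        then show ?thesis by (simp add: Simp_smooth_sset_continuous s_def)
      qed
      then show "s n \<in> Simp (singular_sset A) n \<rightarrow> Simp (smooth_continuous_sset A) n" by blast
    next
      fix n m f \<sigma> assume f: "f \<in> Delta n m" and \<sigma>: "\<sigma> \<in> Simp (singular_sset A) m"
      show "s n (Act (singular_sset A) n m f \<sigma>) = Act (smooth_continuous_sset A) n m f (s m \<sigma>)"
        using h(3)[OF f \<sigma>] push_affine_simplex[OF f]
        by (auto simp: s_def Act_smooth_sset compose_def fun_eq_iff cpush_def)
    qed (rule simplicial_set_smooth_sset simplicial_set_singular_sset)+
    show "simplex_restriction n (s n \<sigma>) = \<sigma>" if "\<sigma> \<in> Simp (singular_sset A) n" for n \<sigma>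
    proof
      fix y
      show "simplex_restriction n (s n \<sigma>) y = \<sigma> y"
        using h(2)[OF that, of "(y, 0)"] that standard_subset_affine[of n]
        by (auto simp: simplex_restriction_def s_def pre Simp_singular_sset extensional_def)
    qed
  qed
qed

text \<open>
  For each simplex \<open>\<sigma>\<close>, a homotopy over the affine simplex from \<open>s (\<rho> \<sigma>)\<close>, with \<open>\<rho>\<close> the restriction,
  to \<open>\<sigma>\<close> that is natural in \<open>\<sigma>\<close>. On the standard simplex both ends agree, so it is prescribed to be
  constant there.
\<close>

lemma section_homotopy:
  fixes A :: "'a topology"
  assumes s: "simplicial_map (singular_sset A) (smooth_continuous_sset A) s"
    and rs: "\<And>n \<sigma>. \<sigma> \<in> Simp (singular_sset A) n \<Longrightarrow> simplex_restriction n (s n \<sigma>) = \<sigma>"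
  obtains H :: "nat \<Rightarrow> ((nat \<Rightarrow> real) \<Rightarrow> 'a) \<Rightarrow> (nat \<Rightarrow> real) \<times> real \<Rightarrow> 'a" where
    "\<And>n \<sigma>. \<sigma> \<in> Simp (smooth_continuous_sset A) n \<Longrightarrow>
        continuous_map (top_of_set (affine_simplex n \<times> {-1..1})) A (H n \<sigma>)"
    "\<And>n \<sigma> y. \<sigma> \<in> Simp (smooth_continuous_sset A) n \<Longrightarrow> y \<in> affine_simplex n \<Longrightarrow>
        H n \<sigma> (y, -1) = s n (simplex_restriction n \<sigma>) y"
    "\<And>n \<sigma> y. \<sigma> \<in> Simp (smooth_continuous_sset A) n \<Longrightarrow> y \<in> affine_simplex n \<Longrightarrow> H n \<sigma> (y, 1) = \<sigma> y"
    "\<And>n m f \<sigma> p. f \<in> Delta n m \<Longrightarrow> \<sigma> \<in> Simp (smooth_continuous_sset A) m \<Longrightarrow> p \<in> affine_simplex n \<times> {-1..1} \<Longrightarrow>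
        H n (Act (smooth_continuous_sset A) n m f \<sigma>) p = H m \<sigma> (cpush n f p)"
proof -
  let ?S = "smooth_continuous_sset A"
  let ?r = simplex_restriction
  define sr where "sr n \<sigma> = s n (?r n \<sigma>)" for n \<sigma>
  define T :: "real set" where "T = {-1..1}"
  have r_simp: "?r n \<sigma> \<in> Simp (singular_sset A) n" if "\<sigma> \<in> Simp ?S n" for n \<sigma>
    using simplicial_map_restriction[of A] that unfolding simplicial_map_def by blast
  have sr_simp: "sr n \<sigma> \<in> Simp ?S n" if "\<sigma> \<in> Simp ?S n" for n \<sigma>
    using s r_simp[OF that] unfolding simplicial_map_def sr_def by blast
  have sr_eq: "sr n \<sigma> y = \<sigma> y" if "\<sigma> \<in> Simp ?S n" "y \<in> standard_simplex n" for n \<sigma> y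
    using rs[OF r_simp[OF that(1)]] that(2) unfolding sr_def simplex_restriction_def
    by (metis restrict_apply')
  have sr_nat: "sr n (Act ?S n m f \<sigma>) = Act ?S n m f (sr m \<sigma>)" if "f \<in> Delta n m" "\<sigma> \<in> Simp ?S m" for n m f \<sigma>
    using simplicial_map_restriction[of A] s r_simp[OF that(2)] that
    unfolding simplicial_map_def sr_def by metis
  define g where "g n \<sigma> p = (if fst p \<in> standard_simplex n \<or> snd p = 1 then \<sigma> (fst p) else sr n \<sigma> (fst p))"
    for n and \<sigma> :: "(nat \<Rightarrow> real) \<Rightarrow> 'a" and p :: "(nat \<Rightarrow> real) \<times> real"
  have g_pos: "g n \<sigma> p = \<sigma> (fst p)" if "fst p \<in> standard_simplex n \<or> snd p = 1" for n \<sigma> p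
    using that by (simp add: g_def)
  have g_neg: "g n \<sigma> p = sr n \<sigma> (fst p)" if "snd p = -1" "\<sigma> \<in> Simp ?S n" for n \<sigma> p
    using that sr_eq[of \<sigma> n "fst p"] by (simp add: g_def)
  have pre: "fst p \<in> affine_simplex n" "fst p \<in> standard_simplex n \<or> snd p = 1 \<or> snd p = -1"
    if "p \<in> prescribed n T" for n p
    using that by (auto simp: prescribed_def)
  interpret extension_problem ?S A T g
  proof
    show "simplicial_set ?S" by (rule simplicial_set_smooth_sset)
    show "T \<subseteq> {-1..1}" by (simp add: T_def)
    show "c * u \<in> T" if "u \<in> T" "\<bar>c * u\<bar> \<le> 1" for u c
      using that by (simp add: T_def abs_le_iff)
    fix n m f \<sigma> p
    assume f: "f \<in> Delta n m" and \<sigma>: "\<sigma> \<in> Simp ?S m" and p: "p \<in> prescribed n T"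
    have "fst (cpush n f p) \<in> standard_simplex m" if "fst p \<in> standard_simplex n"
      using push_standard_simplex[OF f that] by (simp add: cpush_def)
    moreover have "Act ?S n m f \<tau> (fst p) = \<tau> (fst (cpush n f p))" for \<tau> :: "(nat \<Rightarrow> real) \<Rightarrow> 'a"
      using pre(1)[OF p] by (simp add: Act_smooth_sset compose_def cpush_def)
    moreover have "snd (cpush n f p) = snd p" by (simp add: cpush_def)
    ultimately show "g n (Act ?S n m f \<sigma>) p = g m \<sigma> (cpush n f p)"
      using pre(2)[OF p] g_pos[of p n] g_pos[of "cpush n f p" m] g_neg[of "cpush n f p" \<sigma> m]
        g_neg[of p _ n, OF _ simplicial_set_Act[OF simplicial_set_smooth_sset f \<sigma>]] \<sigma> sr_nat[OF f \<sigma>]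
      by metis
  next
    fix n \<sigma> assume \<sigma>: "\<sigma> \<in> Simp ?S n"
    let ?P = "prescribed n T"
    define C where "C b = (if b then {p \<in> ?P. fst p \<in> standard_simplex n \<or> snd p = 1} else {p \<in> ?P. snd p = -1})" for b :: bool
    define k where "k b = (\<lambda>p :: (nat \<Rightarrow> real) \<times> real. (if b then \<sigma> else sr n \<sigma>) (fst p))" for b
    have kg: "k b p = g n \<sigma> p" if "p \<in> C b" for b p
      using that g_pos[of p n \<sigma>] g_neg[OF _ \<sigma>, of p] by (auto simp: C_def k_def split: if_splits)
    show "continuous_map (top_of_set ?P) A (g n \<sigma>)"
    proof (rule pasting_lemma_closed[of "UNIV :: bool set" _ C A k])
      fix b :: bool
      show "closedin (top_of_set ?P) (C b)"
      proof (cases b)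
        case True
        have cl: "closed ({p::(nat \<Rightarrow> real) \<times> real. \<forall>i. 0 \<le> fst p i} \<union> {p. snd p = 1})"
          by (intro closed_Un closed_Collect_all closed_Collect_le closed_Collect_eq
              continuous_intros continuous_on_fst_nth)
        have eq: "C b = ?P \<inter> ({p. \<forall>i. 0 \<le> fst p i} \<union> {p. snd p = 1})"
          using True by (auto simp: C_def standard_simplex_eq prescribed_def)
        show ?thesis using closedin_closed_Int[OF cl, of ?P] unfolding eq .
      next
        case False
        have cl: "closed {p::(nat \<Rightarrow> real) \<times> real. snd p = -1}"
          by (intro closed_Collect_eq continuous_intros)
        have eq: "C b = ?P \<inter> {p. snd p = -1}"
          using False by (auto simp: C_def)
        show ?thesis using closedin_closed_Int[OF cl, of ?P] unfolding eq .
      qed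
      have "(if b then \<sigma> else sr n \<sigma>) \<in> Simp ?S n" using \<sigma> sr_simp by simp
      then have c: "continuous_map (top_of_set (affine_simplex n)) A (if b then \<sigma> else sr n \<sigma>)"
        by (simp add: Simp_smooth_sset_continuous)
      have "continuous_map (top_of_set (?P \<inter> C b)) (top_of_set (affine_simplex n)) fst"
        using pre(1) by (auto intro: continuous_on_fst continuous_on_id)
      then have "continuous_map (top_of_set (?P \<inter> C b)) A ((if b then \<sigma> else sr n \<sigma>) \<circ> fst)"
        using c by (rule continuous_map_compose)
      then show "continuous_map (subtopology (top_of_set ?P) (C b)) A (k b)"
        by (simp add: k_def o_def subtopology_subtopology)
    next
      fix p assume "p \<in> topspace (top_of_set ?P)"
      then have p: "p \<in> ?P" by simp
      have "p \<in> C True \<or> p \<in> C False" using pre(2)[OF p] p by (auto simp: C_def)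
      then obtain j where j: "p \<in> C j" by blast
      then show "\<exists>j. j \<in> UNIV \<and> p \<in> C j \<and> g n \<sigma> p = k j p"
        by (intro exI[of _ j] conjI UNIV_I kg[OF j, symmetric])
    next
      fix i j p assume "p \<in> topspace (top_of_set ?P) \<inter> C i \<inter> C j"
      then have "p \<in> C i" "p \<in> C j" by blast+
      then show "k i p = k j p" using kg[of p i] kg[of p j] by (simp only:)
    qed (rule finite)
  qed
  obtain h where h: "\<And>n \<sigma>. \<sigma> \<in> Simp ?S n \<Longrightarrow> continuous_map (top_of_set (affine_simplex n \<times> T)) A (h n \<sigma>)"
      "\<And>n \<sigma> p. \<sigma> \<in> Simp ?S n \<Longrightarrow> p \<in> prescribed n T \<Longrightarrow> h n \<sigma> p = g n \<sigma> p"
      "\<And>n m f \<sigma> p. f \<in> Delta n m \<Longrightarrow> \<sigma> \<in> Simp ?S m \<Longrightarrow> p \<in> affine_simplex n \<times> T \<Longrightarrow>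
        h n (Act ?S n m f \<sigma>) p = h m \<sigma> (cpush n f p)"
    using extension_exists by blast
  show ?thesis
  proof (rule that[of h])
    show "h n \<sigma> (y, -1) = s n (?r n \<sigma>) y" if "\<sigma> \<in> Simp ?S n" "y \<in> affine_simplex n" for n \<sigma> y
      using h(2)[OF that(1), of "(y, -1)"] that(2) g_neg[OF _ that(1), of "(y, -1)"]
      by (simp add: prescribed_def T_def sr_def)
    show "h n \<sigma> (y, 1) = \<sigma> y" if "\<sigma> \<in> Simp ?S n" "y \<in> affine_simplex n" for n \<sigma> y
      using h(2)[OF that(1), of "(y, 1)"] that(2) by (simp add: prescribed_def T_def g_def)
  qed (use h(1,3) in \<open>simp_all add: T_def\<close>)
qed

section \<open>Joins of simplices and the homotopy on the realization\<close>

text \<open>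
  The ordered set $[2n+1]$ is the concatenation of two copies of $[n]$. The join of \<open>f\<close> with itself
  acts as \<open>f\<close> on each copy.
\<close>

definition join_map :: "nat \<Rightarrow> nat \<Rightarrow> (nat \<Rightarrow> nat) \<Rightarrow> nat \<Rightarrow> nat" where
  "join_map n m f = (\<lambda>i\<in>{..2*n+1}. if i \<le> n then f i else m + 1 + f (i - (n + 1)))"

text \<open>The affine map that identifies the two copies.\<close>

definition join_fold :: "nat \<Rightarrow> (nat \<Rightarrow> real) \<Rightarrow> nat \<Rightarrow> real" where
  "join_fold n x = (\<lambda>j. if j \<le> n then x j + x (n + 1 + j) else 0)"

text \<open>The sum of the coordinates that belong to the second copy.\<close>

definition join_weight :: "nat \<Rightarrow> (nat \<Rightarrow> real) \<Rightarrow> real" where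
  "join_weight n x = (\<Sum>j\<le>n. x (n + 1 + j))"

text \<open>
  The point at time \<open>v\<close> on the segment from \<open>t\<close> in the first copy to \<open>t\<close> in the second copy.
\<close>

definition join_point :: "nat \<Rightarrow> real \<Rightarrow> (nat \<Rightarrow> real) \<Rightarrow> nat \<Rightarrow> real" where
  "join_point n v t = (\<lambda>i. if i \<le> n then (1 - v) * t i
     else if i \<le> 2*n+1 then v * t (i - (n + 1)) else 0)"

lemma sum_join:
  fixes x :: "nat \<Rightarrow> real"
  shows "(\<Sum>i\<le>2*n+1. x i) = (\<Sum>j\<le>n. x j) + (\<Sum>j\<le>n. x (n + 1 + j))"
proof -
  have "(\<Sum>i\<le>2*n+1. x i) = (\<Sum>i\<in>{..n} \<union> {n+1..2*n+1}. x i)"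
    by (intro sum.cong) auto
  also have "\<dots> = (\<Sum>i\<le>n. x i) + (\<Sum>i\<in>{n+1..2*n+1}. x i)"
    by (intro sum.union_disjoint) auto
  also have "(\<Sum>i\<in>{n+1..2*n+1}. x i) = (\<Sum>j\<le>n. x (n + 1 + j))"
    by (rule sum.reindex_bij_witness[of _ "\<lambda>j. n + 1 + j" "\<lambda>i. i - (n + 1)"]) auto
  finally show ?thesis .
qed

lemma join_map_Delta:
  assumes f: "f \<in> Delta n m"
  shows "join_map n m f \<in> Delta (2*n+1) (2*m+1)"
proof (rule DeltaI)
  fix i assume i: "i \<le> 2*n+1"
  show "join_map n m f i \<le> 2*m+1"
    using i Delta_le[OF f, of i] Delta_le[OF f, of "i - (n + 1)"] by (auto simp: join_map_def)
next
  fix i j assume ij: "i \<le> j" "j \<le> 2*n+1"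
  show "join_map n m f i \<le> join_map n m f j"
    using ij Delta_mono[OF f, of i j] Delta_mono[OF f, of "i - (n + 1)" "j - (n + 1)"] Delta_le[OF f, of i]
    by (auto simp: join_map_def)
qed (simp add: join_map_def)

lemma push_join_low:
  assumes f: "f \<in> Delta n m" and k: "k \<le> m"
  shows "push (2*n+1) (join_map n m f) x k = push n f x k"
  unfolding push_def using k by (intro sum.cong) (auto simp: join_map_def split: if_splits)

lemma push_join_high:
  assumes f: "f \<in> Delta n m" and k: "k \<le> m"
  shows "push (2*n+1) (join_map n m f) x (m + 1 + k) = push n f (\<lambda>i. x (n + 1 + i)) k"
proof -
  have "(\<Sum>i | i \<le> 2*n+1 \<and> join_map n m f i = m + 1 + k. x i) = (\<Sum>i | i \<le> n \<and> f i = k. x (n + 1 + i))"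
  proof (rule sum.reindex_bij_witness[of _ "\<lambda>j. n + 1 + j" "\<lambda>i. i - (n + 1)"])
    fix i assume "i \<in> {i. i \<le> 2*n+1 \<and> join_map n m f i = m + 1 + k}"
    moreover from this have "\<not> i \<le> n" using Delta_le[OF f, of i] by (auto simp: join_map_def)
    ultimately show "n + 1 + (i - (n + 1)) = i" "i - (n + 1) \<in> {i. i \<le> n \<and> f i = k}"
      "x (n + 1 + (i - (n + 1))) = x i"
      by (auto simp: join_map_def)
  qed (auto simp: join_map_def)
  then show ?thesis by (simp add: push_def)
qed

lemma join_fold_affine: "x \<in> affine_simplex (2*n+1) \<Longrightarrow> join_fold n x \<in> affine_simplex n"
  using sum_join[of x n] by (auto simp: mem_affine_simplex_iff join_fold_def sum.distrib)

lemma join_fold_push: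
  assumes f: "f \<in> Delta n m"
  shows "join_fold m (push (2*n+1) (join_map n m f) x) = push n f (join_fold n x)"
proof
  fix j
  show "join_fold m (push (2*n+1) (join_map n m f) x) j = push n f (join_fold n x) j"
  proof (cases "j \<le> m")
    case True
    have "push n f (join_fold n x) j = push n f x j + push n f (\<lambda>i. x (n + 1 + i)) j"
      by (simp add: push_def join_fold_def sum.distrib)
    then show ?thesis using push_join_low[OF f True] push_join_high[OF f True] True
      by (simp add: join_fold_def)
  next
    case False
    then show ?thesis using push_eq_0[OF f, of j] by (simp add: join_fold_def)
  qed
qed

lemma join_weight_push:
  assumes f: "f \<in> Delta n m"
  shows "join_weight m (push (2*n+1) (join_map n m f) x) = join_weight n x"
proof -
  have "join_weight m (push (2*n+1) (join_map n m f) x) = (\<Sum>j\<le>m. push n f (\<lambda>i. x (n + 1 + i)) j)"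
    unfolding join_weight_def by (intro sum.cong refl push_join_high[OF f]) auto
  then show ?thesis using sum_push[OF f] by (simp add: join_weight_def)
qed

lemma join_point_standard:
  assumes v: "v \<in> {0..1}" and t: "t \<in> standard_simplex n"
  shows "join_point n v t \<in> standard_simplex (2*n+1)"
proof -
  have "(\<Sum>i\<le>2*n+1. join_point n v t i) = (\<Sum>j\<le>n. (1 - v) * t j) + (\<Sum>j\<le>n. v * t j)"
    unfolding sum_join by (intro arg_cong2[where f = "(+)"] sum.cong) (auto simp: join_point_def)
  also have "\<dots> = 1"
    using t by (simp add: standard_simplex_def flip: sum_distrib_left)
  finally show ?thesis
    using v t by (auto simp: standard_simplex_eq mem_affine_simplex_iff join_point_def)
qed

lemma push_join_point:
  assumes f: "f \<in> Delta n m"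
  shows "push (2*n+1) (join_map n m f) (join_point n v t) = join_point m v (push n f t)"
proof
  fix k
  consider "k \<le> m" | j where "k = m + 1 + j" "j \<le> m" | "k > 2*m+1"
  proof -
    have "k \<le> m \<or> (k = m + 1 + (k - (m + 1)) \<and> k - (m + 1) \<le> m) \<or> k > 2*m+1" by linarith
    then show thesis using that by blast
  qed
  then show "push (2*n+1) (join_map n m f) (join_point n v t) k = join_point m v (push n f t) k"
  proof cases
    case 1
    have "push n f (join_point n v t) k = (1 - v) * push n f t k"
      unfolding push_def sum_distrib_left by (intro sum.cong) (auto simp: join_point_def)
    then show ?thesis using push_join_low[OF f 1] 1 by (simp add: join_point_def)
  next
    case 2
    have "push n f (\<lambda>i. join_point n v t (n + 1 + i)) j = v * push n f t j"
      unfolding push_def sum_distrib_left by (intro sum.cong) (auto simp: join_point_def)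
    then show ?thesis using push_join_high[OF f 2(2)] 2 by (simp add: join_point_def)
  next
    case 3
    then show ?thesis using push_eq_0[OF join_map_Delta[OF f], of k] by (simp add: join_point_def)
  qed
qed

lemma continuous_map_join_point:
  "continuous_map (prod_topology (top_of_set {0..1}) (top_of_set (standard_simplex n)))
     (top_of_set (standard_simplex (2*n+1))) (\<lambda>z. join_point n (fst z) (snd z))"
proof -
  have nth: "continuous_on ({0..1} \<times> standard_simplex n) (\<lambda>z::real \<times> (nat \<Rightarrow> real). snd z i)" for i
    by (rule continuous_on_compose2[OF continuous_on_nth[of UNIV i] continuous_on_snd[OF continuous_on_id]]) auto
  have "continuous_on ({0..1} \<times> standard_simplex n) (\<lambda>z. join_point n (fst z) (snd z))"
    unfolding join_point_def
  proof (rule continuous_on_coordinatewise_then_product)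
    fix i
    show "continuous_on ({0..1} \<times> standard_simplex n) (\<lambda>z. if i \<le> n then (1 - fst z) * snd z i
        else if i \<le> 2*n+1 then fst z * snd z (i - (n + 1)) else 0)"
      by (cases "i \<le> n"; cases "i \<le> 2*n+1") (auto intro!: continuous_intros nth)
  qed
  then show ?thesis using join_point_standard by auto
qed

lemma realization_homotopy:
  fixes A :: "'a topology"
  assumes s: "simplicial_map (singular_sset A) (smooth_continuous_sset A) s"
    and rs: "\<And>n \<sigma>. \<sigma> \<in> Simp (singular_sset A) n \<Longrightarrow> simplex_restriction n (s n \<sigma>) = \<sigma>"
  obtains K where
    "continuous_map (prod_topology (top_of_set {0..1::real}) (realization (smooth_continuous_sset A)))
       (realization (smooth_continuous_sset A)) K"
    "\<And>n \<sigma> t. \<sigma> \<in> Simp (smooth_continuous_sset A) n \<Longrightarrow> t \<in> standard_simplex n \<Longrightarrow>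
       K (0, realization_rel (smooth_continuous_sset A) `` {(n, \<sigma>, t)}) =
         realization_rel (smooth_continuous_sset A) `` {(n, s n (simplex_restriction n \<sigma>), t)}"
    "\<And>n \<sigma> t. \<sigma> \<in> Simp (smooth_continuous_sset A) n \<Longrightarrow> t \<in> standard_simplex n \<Longrightarrow>
       K (1, realization_rel (smooth_continuous_sset A) `` {(n, \<sigma>, t)}) =
         realization_rel (smooth_continuous_sset A) `` {(n, \<sigma>, t)}"
proof -
  let ?S = "smooth_continuous_sset A"
  obtain H where Hc: "\<And>n \<sigma>. \<sigma> \<in> Simp ?S n \<Longrightarrow> continuous_map (top_of_set (affine_simplex n \<times> {-1..1})) A (H n \<sigma>)"
    and H0: "\<And>n \<sigma> y. \<sigma> \<in> Simp ?S n \<Longrightarrow> y \<in> affine_simplex n \<Longrightarrow>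
        H n \<sigma> (y, -1) = s n (simplex_restriction n \<sigma>) y"
    and H1: "\<And>n \<sigma> y. \<sigma> \<in> Simp ?S n \<Longrightarrow> y \<in> affine_simplex n \<Longrightarrow> H n \<sigma> (y, 1) = \<sigma> y"
    and Hn: "\<And>n m f \<sigma> p. f \<in> Delta n m \<Longrightarrow> \<sigma> \<in> Simp ?S m \<Longrightarrow> p \<in> affine_simplex n \<times> {-1..1} \<Longrightarrow>
        H n (Act ?S n m f \<sigma>) p = H m \<sigma> (cpush n f p)"
    using section_homotopy[OF s rs] by blast
  \<comment> \<open>The weight is unbounded on the affine simplex. It is rescaled so that 0 and 1 become -1 and 1,
     and then clamped.\<close>
  define e where "e n x = (join_fold n x, max (-1) (min 1 (2 * join_weight n x - 1)))" for n x
  have eA: "e n x \<in> affine_simplex n \<times> {-1..1}" if "x \<in> affine_simplex (2*n+1)" for n x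
    using join_fold_affine[OF that] by (auto simp: e_def)
  have fold_cont: "continuous_on U (join_fold n)" for U n
    unfolding join_fold_def
  proof (rule continuous_on_coordinatewise_then_product)
    show "continuous_on U (\<lambda>x. if j \<le> n then x j + x (n + 1 + j) else 0)" for j
      by (cases "j \<le> n") (auto intro!: continuous_intros continuous_on_nth)
  qed
  have e_cont: "continuous_on U (e n)" for U n
    unfolding e_def join_weight_def
    by (intro continuous_on_Pair fold_cont continuous_on_max continuous_on_min continuous_on_diff
        continuous_on_mult continuous_on_sum continuous_on_const continuous_on_nth)
  define \<tau> where "\<tau> n \<sigma> = restrict (\<lambda>x. H n \<sigma> (e n x)) (affine_simplex (2*n+1))" for n \<sigma>
  have \<tau>_simp: "\<tau> n \<sigma> \<in> Simp ?S (2*n+1)" if "\<sigma> \<in> Simp ?S n" for n \<sigma>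
  proof -
    have "continuous_map (top_of_set (affine_simplex (2*n+1))) (top_of_set (affine_simplex n \<times> {-1..1})) (e n)"
      using e_cont eA by auto
    then have "continuous_map (top_of_set (affine_simplex (2*n+1))) A (H n \<sigma> \<circ> e n)"
      using Hc[OF that] by (rule continuous_map_compose)
    then have "continuous_map (top_of_set (affine_simplex (2*n+1))) A (\<tau> n \<sigma>)"
      by (rule continuous_map_eq) (simp add: \<tau>_def)
    then show ?thesis by (simp add: Simp_smooth_sset_continuous \<tau>_def)
  qed
  have \<tau>_nat: "\<tau> n (Act ?S n m f \<sigma>) = Act ?S (2*n+1) (2*m+1) (join_map n m f) (\<tau> m \<sigma>)"
    if f: "f \<in> Delta n m" and \<sigma>: "\<sigma> \<in> Simp ?S m" for n m f \<sigma>
  proof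
    fix x
    show "\<tau> n (Act ?S n m f \<sigma>) x = Act ?S (2*n+1) (2*m+1) (join_map n m f) (\<tau> m \<sigma>) x"
    proof (cases "x \<in> affine_simplex (2*n+1)")
      case True
      have "cpush n f (e n x) = e m (push (2*n+1) (join_map n m f) x)"
        using join_fold_push[OF f] join_weight_push[OF f] by (simp add: cpush_def e_def)
      then show ?thesis
        using True Hn[OF f \<sigma> eA[OF True]] push_affine_simplex[OF join_map_Delta[OF f] True]
        by (simp add: \<tau>_def Act_smooth_sset compose_def)
    qed (simp add: \<tau>_def Act_smooth_sset compose_def)
  qed
  \<comment> \<open>the inclusions of the two copies\<close>
  define \<iota>1 where "\<iota>1 n = (\<lambda>i\<in>{..n}. n + 1 + i)" for n :: nat
  let ?\<iota>0 = "\<lambda>n::nat. \<lambda>i\<in>{..n}. i"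
  have \<iota>0: "?\<iota>0 n \<in> Delta n (2*n+1)" and \<iota>1: "\<iota>1 n \<in> Delta n (2*n+1)" for n
    by (auto intro!: DeltaI simp: \<iota>1_def)
  have push0: "push n (?\<iota>0 n) x = x" if "x \<in> affine_simplex n" for n x
    using that by (intro push_id) (auto simp: mem_affine_simplex_iff)
  have push1: "push n (\<iota>1 n) x = (\<lambda>k. if n + 1 \<le> k \<and> k \<le> 2*n+1 then x (k - (n + 1)) else 0)" for n x
  proof
    fix k
    have "{i. i \<le> n \<and> \<iota>1 n i = k} = (if n + 1 \<le> k \<and> k \<le> 2*n+1 then {k - (n + 1)} else {})"
      by (auto simp: \<iota>1_def)
    then show "push n (\<iota>1 n) x k = (if n + 1 \<le> k \<and> k \<le> 2*n+1 then x (k - (n + 1)) else 0)"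
      by (simp add: push_def)
  qed
  have end0: "Act ?S n (2*n+1) (?\<iota>0 n) (\<tau> n \<sigma>) = s n (simplex_restriction n \<sigma>)" if \<sigma>: "\<sigma> \<in> Simp ?S n" for n \<sigma>
  proof
    fix x
    have ext: "s n (simplex_restriction n \<sigma>) \<in> Simp ?S n"
      using s simplicial_map_restriction[of A] \<sigma> unfolding simplicial_map_def by blast
    show "Act ?S n (2*n+1) (?\<iota>0 n) (\<tau> n \<sigma>) x = s n (simplex_restriction n \<sigma>) x"
    proof (cases "x \<in> affine_simplex n")
      case True
      then have "x \<in> affine_simplex (2*n+1)" using push_affine_simplex[OF \<iota>0 True] push0[OF True] by simp
      moreover have "e n x = (x, -1)"
        using True by (auto simp: e_def join_fold_def join_weight_def mem_affine_simplex_iff fun_eq_iff)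
      ultimately show ?thesis
        using True H0[OF \<sigma> True] by (simp add: Act_smooth_sset compose_def push0 \<tau>_def)
    next
      case False
      then show ?thesis using ext
        by (simp add: Act_smooth_sset compose_def Simp_smooth_sset_continuous extensional_def)
    qed
  qed
  have end1: "Act ?S n (2*n+1) (\<iota>1 n) (\<tau> n \<sigma>) = \<sigma>" if \<sigma>: "\<sigma> \<in> Simp ?S n" for n \<sigma>
  proof
    fix x
    show "Act ?S n (2*n+1) (\<iota>1 n) (\<tau> n \<sigma>) x = \<sigma> x"
    proof (cases "x \<in> affine_simplex n")
      case True
      have "e n (push n (\<iota>1 n) x) = (x, 1)"
        using True by (auto simp: push1 e_def join_fold_def join_weight_def mem_affine_simplex_iff fun_eq_iff)
      then show ?thesis
        using True H1[OF \<sigma> True] push_affine_simplex[OF \<iota>1 True]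
        by (simp add: Act_smooth_sset compose_def \<tau>_def)
    next
      case False
      then show ?thesis using \<sigma>
        by (simp add: Act_smooth_sset compose_def Simp_smooth_sset_continuous extensional_def)
    qed
  qed
  define G where "G v n \<sigma> t = realization_rel ?S `` {(2*n+1, \<tau> n \<sigma>, join_point n v t)}" for v n \<sigma> t
  have G_cont: "continuous_map (prod_topology (top_of_set {0..1}) (top_of_set (standard_simplex n)))
      (realization ?S) (\<lambda>(v, t). G v n \<sigma> t)" if "\<sigma> \<in> Simp ?S n" for n \<sigma>
    unfolding G_def case_prod_unfold
    by (rule continuous_map_simplex_class[OF \<tau>_simp[OF that] continuous_map_join_point])
  have G_glue: "G v n (Act ?S n m f \<sigma>) t = G v m \<sigma> (push n f t)"
    if f: "f \<in> Delta n m" and \<sigma>: "\<sigma> \<in> Simp ?S m" and t: "t \<in> standard_simplex n" and v: "v \<in> {0..1}" for v n m f \<sigma> t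
    using realization_class_Act[OF join_map_Delta[OF f] \<tau>_simp[OF \<sigma>] join_point_standard[OF v t]]
    by (simp only: G_def \<tau>_nat[OF f \<sigma>] push_join_point[OF f])
  obtain K where K: "continuous_map (prod_topology (top_of_set {0..1::real}) (realization ?S)) (realization ?S) K"
    and KG: "\<And>v n \<sigma> t. \<sigma> \<in> Simp ?S n \<Longrightarrow> t \<in> standard_simplex n \<Longrightarrow> v \<in> {0..1} \<Longrightarrow>
        K (v, realization_rel ?S `` {(n, \<sigma>, t)}) = G v n \<sigma> t"
  proof (rule continuous_map_realization_homotopy[of ?S 0 1 "realization ?S" G, OF G_cont G_glue])
    fix K
    assume "continuous_map (prod_topology (top_of_set {0..1::real}) (realization ?S)) (realization ?S) K"
      "\<And>v n \<sigma> t. \<sigma> \<in> Simp ?S n \<Longrightarrow> t \<in> standard_simplex n \<Longrightarrow> v \<in> {0..1} \<Longrightarrow>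
        K (v, realization_rel ?S `` {(n, \<sigma>, t)}) = G v n \<sigma> t"
    then show thesis by (rule that)
  qed
  show ?thesis
  proof (rule that[OF K])
    fix n \<sigma> t assume \<sigma>: "\<sigma> \<in> Simp ?S n" and t: "t \<in> standard_simplex n"
    have tA: "t \<in> affine_simplex n" by (rule subsetD[OF standard_subset_affine t])
    have "join_point n 0 t = push n (?\<iota>0 n) t"
      using tA by (simp add: push0[OF tA]) (auto simp: join_point_def mem_affine_simplex_iff fun_eq_iff)
    then have "G 0 n \<sigma> t = realization_rel ?S `` {(n, s n (simplex_restriction n \<sigma>), t)}"
      using realization_class_Act[OF \<iota>0 \<tau>_simp[OF \<sigma>] t] end0[OF \<sigma>] by (simp add: G_def)
    then show "K (0, realization_rel ?S `` {(n, \<sigma>, t)}) =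
        realization_rel ?S `` {(n, s n (simplex_restriction n \<sigma>), t)}"
      using KG[OF \<sigma> t, of 0] by simp
    have "join_point n 1 t = push n (\<iota>1 n) t"
      by (auto simp: push1 join_point_def fun_eq_iff)
    then have "G 1 n \<sigma> t = realization_rel ?S `` {(n, \<sigma>, t)}"
      using realization_class_Act[OF \<iota>1 \<tau>_simp[OF \<sigma>] t] end1[OF \<sigma>] by (simp add: G_def)
    then show "K (1, realization_rel ?S `` {(n, \<sigma>, t)}) = realization_rel ?S `` {(n, \<sigma>, t)}"
      using KG[OF \<sigma> t, of 1] by simp
  qed
qed

lemma weak_equivalence_restriction:
  fixes A :: "'a topology"
  shows "weak_equivalence (smooth_continuous_sset A) (singular_sset A) simplex_restriction"
proof -
  let ?S = "smooth_continuous_sset A" and ?sA = "singular_sset A"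
  obtain s where s: "simplicial_map ?sA ?S s"
    and rs: "\<And>n \<sigma>. \<sigma> \<in> Simp ?sA n \<Longrightarrow> simplex_restriction n (s n \<sigma>) = \<sigma>"
    using restriction_section by blast
  note r = simplicial_map_restriction[of A]
  let ?r = "realization_map ?sA simplex_restriction" and ?s = "realization_map ?S s"
  obtain K where K: "continuous_map (prod_topology (top_of_set {0..1::real}) (realization ?S)) (realization ?S) K"
    and K0: "\<And>n \<sigma> t. \<sigma> \<in> Simp ?S n \<Longrightarrow> t \<in> standard_simplex n \<Longrightarrow>
       K (0, realization_rel ?S `` {(n, \<sigma>, t)}) = realization_rel ?S `` {(n, s n (simplex_restriction n \<sigma>), t)}"
    and K1: "\<And>n \<sigma> t. \<sigma> \<in> Simp ?S n \<Longrightarrow> t \<in> standard_simplex n \<Longrightarrow>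
       K (1, realization_rel ?S `` {(n, \<sigma>, t)}) = realization_rel ?S `` {(n, \<sigma>, t)}"
    using realization_homotopy[OF s rs] by blast
  have cr: "continuous_map (realization ?S) (realization ?sA) ?r"
    and cs: "continuous_map (realization ?sA) (realization ?S) ?s"
    by (rule continuous_map_realization_map[OF r] continuous_map_realization_map[OF s])+
  have "homotopic_with (\<lambda>_. True) (realization ?S) (realization ?S) (?s \<circ> ?r) id"
  proof (subst homotopic_with, simp, intro exI[of _ K] conjI ballI K)
    fix C assume "C \<in> topspace (realization ?S)"
    then obtain n \<sigma> t where C: "C = realization_rel ?S `` {(n, \<sigma>, t)}" "\<sigma> \<in> Simp ?S n" "t \<in> standard_simplex n"
      by (auto simp: topspace_realization)
    show "K (0, C) = (?s \<circ> ?r) C"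
      using C K0 by (simp add: realization_map_class[OF r] realization_map_class[OF s])
    show "K (1, C) = id C" using C K1 by simp
  qed auto
  moreover have "homotopic_with (\<lambda>_. True) (realization ?sA) (realization ?sA) (?r \<circ> ?s) id"
  proof (rule homotopic_with_equal)
    show "continuous_map (realization ?sA) (realization ?sA) (?r \<circ> ?s)"
      by (rule continuous_map_compose[OF cs cr])
    fix C assume "C \<in> topspace (realization ?sA)"
    then obtain n \<sigma> t where "C = realization_rel ?sA `` {(n, \<sigma>, t)}" "\<sigma> \<in> Simp ?sA n"
      by (auto simp: topspace_realization)
    then show "(?r \<circ> ?s) C = id C"
      using rs by (simp add: realization_map_class[OF r] realization_map_class[OF s])
  qed auto
  ultimately show ?thesis
    unfolding weak_equivalence_def homotopy_equivalence_map_def using r cr cs by blast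
qed

theorem proposition4p14:
  fixes A :: "'a topology"
  shows "(\<exists>\<phi>. weak_equivalence (smooth_sset (continuous_diffeology A)) (singular_sset A) \<phi>) \<or>
         (\<exists>\<phi>. weak_equivalence (singular_sset A) (smooth_sset (continuous_diffeology A)) \<phi>)"
  using weak_equivalence_restriction by blast

end
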